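(* Let $k\geq 1$ be a fixed integer, let $\varepsilon>0$, and let $p=p(n)>n^{-1+\varepsilon}$. Then there exists a set $\mathcal{Q}=\mathcal{Q}(n)\subset\binom{[n]}{2}$ of size at most $$\frac{3}{n^{k-2}p^k}\,e^{n^kp^{k+1}}\ln n$$ such that whp $G_n\sim G(n,p)$ is $\mathcal{Q}$-reconstructible.
   Context: $[n]:=\{1,\ldots,n\}$. $G(n,p)$ is the binomial random graph on vertex set $[n]$: each pair of vertices is an edge independently with probability $p$. "Whp" (with high probability) means with probability tending to $1$ as $n\to\infty$. The set $\mathcal{Q}(n)$ is deterministic (it does not depend on the random graph). For a graph $G$ on $[n]$, $d_G(x,y)$ is the graph distance between $x$ and $y$ in $G$ ($\infty$ if they lie in different components). A graph $G$ on $[n]$ is $\mathcal{Q}$-reconstructible, for a set $\mathcal{Q}\subset\binom{[n]}{2}$ of pairs of vertices, if for every graph $G'$ on $[n]$ such that $d_{G'}(x,y)=d_G(x,y)$ for all $\{x,y\}\in\mathcal{Q}$, we have $G'=G$. *)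

theory Defs
  imports "HOL-Probability.Probability" "HOL-Library.Ramsey" "HOL-Library.Extended_Nat"
begin

text \<open>
  A graph on the vertex set \<open>{1..n}\<close> is represented by its edge set, a subset of
  \<open>nsets {1..n} 2\<close> (the two-element subsets of \<open>{1..n}\<close>).
\<close>

definition path_between :: "nat set set \<Rightarrow> nat \<Rightarrow> nat \<Rightarrow> nat list \<Rightarrow> bool" where
  "path_between E x y vs \<longleftrightarrow>
     vs \<noteq> [] \<and> hd vs = x \<and> last vs = y \<and> distinct vs \<and>
     successively (\<lambda>u v. {u, v} \<in> E) vs"

text \<open>The infimum of the empty set in \<^typ>\<open>enat\<close> is \<open>\<infinity>\<close>, so vertices in different
  components have distance \<open>\<infinity>\<close>.\<close>

definition graph_dist :: "nat set set \<Rightarrow> nat \<Rightarrow> nat \<Rightarrow> enat" where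
  "graph_dist E x y = (INF vs \<in> {vs. path_between E x y vs}. enat (length vs - 1))"

definition reconstructible :: "nat \<Rightarrow> nat set set \<Rightarrow> nat set set \<Rightarrow> bool" where
  "reconstructible n Q E \<longleftrightarrow>
     (\<forall>E' \<subseteq> nsets {1..n} 2.
        (\<forall>x y. {x, y} \<in> Q \<longrightarrow> graph_dist E' x y = graph_dist E x y) \<longrightarrow> E' = E)"

definition binomial_random_graph :: "nat \<Rightarrow> real \<Rightarrow> nat set set pmf" where
  "binomial_random_graph n p =
     map_pmf (\<lambda>f. {e \<in> nsets {1..n} 2. f e})
       (Pi_pmf (nsets {1..n} 2) False (\<lambda>_. bernoulli_pmf p))"

end

theory Submission
  imports Defs "HOL-Real_Asymp.Real_Asymp"
begin

text \<open>
  Write \<open>d = n p\<close> for the average degree and \<open>\<Lambda> = n^k p^(k+1)\<close> for the expected number of paths of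
  length \<open>k + 1\<close> between two given vertices, up to lower order terms. If \<open>d^k\<close> is much smaller than \<open>n\<close>,
  then two random vertices are at distance greater than \<open>k + 1\<close> with probability about \<open>exp (-\<Lambda>)\<close>.

  If \<open>3 exp \<Lambda> ln n \<ge> d^k\<close>, the allowed number of queries is at least \<open>n\<^sup>2\<close>, and all pairs can be
  queried. Otherwise \<open>\<Lambda> < k ln n\<close>, hence \<open>d^k\<close> is smaller than \<open>n\<close> by a power of \<open>n\<close>. In this case
  the queries are all pairs that meet one vertex set \<open>S\<close> of size about \<open>3 exp \<Lambda> ln n n / d^k\<close>. The
  answers are then complete distance tables from every \<open>s \<in> S\<close>, so a competing graph \<open>G'\<close> has the
  same breadth-first layers around \<open>s\<close> as \<open>G\<close>, whatever its edges are. This avoids any union bound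
  over competing graphs.

  Fix \<open>u \<noteq> v\<close> and let \<open>H\<close> be \<open>G\<close> without the pair \<open>uv\<close>. Suppose that some \<open>s \<in> S\<close> satisfies
  \<open>d\<^sub>H(s,u) \<le> k\<close> and \<open>d\<^sub>H(s,v) \<ge> k + 2\<close>. If \<open>uv\<close> is not an edge of \<open>G\<close>, then it cannot be an edge of
  \<open>G'\<close>, because the distances of \<open>u\<close> and \<open>v\<close> from \<open>s\<close> differ by at least two. If this is so for all
  pairs, then \<open>G' \<subseteq> G\<close>. If \<open>uv\<close> is an edge of \<open>G\<close>, then \<open>d\<^sub>G(s,v) \<le> k + 1\<close>, and a subgraph of \<open>G\<close>
  can have this distance only if it contains \<open>uv\<close>. So \<open>G' = G\<close> (\<open>reconstructible_if_certified\<close>).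

  It remains to see that such an \<open>s\<close> exists for every pair, with failure probability \<open>o(n^-2)\<close> per
  pair. Expose the edges that touch the ball of radius \<open>k - 2\<close> around \<open>u\<close> or the ball of radius
  \<open>k - 1\<close> around \<open>v\<close>, in \<open>H\<close>. This determines the next layers, a set \<open>M\<close> of about \<open>d^(k-1)\<close>
  vertices at distance \<open>k - 1\<close> from \<open>u\<close> and a set \<open>K\<close> of at most about \<open>d^k\<close> vertices at distance
  \<open>k\<close> from \<open>v\<close>, while the edges from these layers to the remaining vertices are still independent.
  A remaining vertex \<open>s\<close> is good if it has a neighbour in \<open>M\<close> and none in \<open>K\<close>, which has probability
  about \<open>p d^(k-1) exp (-p d^k) = (d^k / n) exp (-\<Lambda>)\<close>. If \<open>S\<close> contains each vertex independently
  with probability \<open>r = 2.8 exp \<Lambda> ln n / d^k\<close>, then no good vertex lies in \<open>S\<close> with probability about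
  \<open>n^-2.8\<close>, which beats the \<open>n\<^sup>2\<close> pairs (\<open>expect_power_card_witnesses_le\<close>).

  The upper bound on \<open>K\<close> comes from the maximum degree, which must be known up to a factor
  \<open>1 + o(1/ln n)\<close> because the bound enters the exponent \<open>\<Lambda>\<close>. The lower bound on \<open>M\<close> needs that few
  vertices of \<open>M\<close> are close to \<open>v\<close>. Expose first the ball around \<open>v\<close> in \<open>G\<close> without the vertex \<open>u\<close>:
  outside this ball the graph is a fresh random graph, in which all small sets expand, so the layers
  around \<open>u\<close> grow by a factor of almost \<open>d\<close> while staying outside (\<open>card_goal_set_ge\<close>,
  \<open>prob_small_goal_set_le\<close>). Finally, averaging over \<open>S\<close> yields one fixed set that works
  (\<open>exists_reconstructing_set\<close>).
\<close>

section \<open>Random subsets and exposing parts of them\<close>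

text \<open>
  This covers both the edge set of the binomial random graph and the random vertex set \<open>S\<close>.
\<close>

definition random_subset :: "'a set \<Rightarrow> real \<Rightarrow> 'a set pmf" where
  "random_subset I p = map_pmf (\<lambda>f. {e \<in> I. f e}) (Pi_pmf I False (\<lambda>_. bernoulli_pmf p))"

abbreviation expect :: "'a set \<Rightarrow> real \<Rightarrow> ('a set \<Rightarrow> real) \<Rightarrow> real" where
  "expect I p f \<equiv> measure_pmf.expectation (random_subset I p) f"

lemma binomial_random_graph_eq: "binomial_random_graph n p = random_subset (nsets {1..n} 2) p"
  by (simp add: binomial_random_graph_def random_subset_def)

lemma set_random_subset: "set_pmf (random_subset I p) \<subseteq> Pow I"
  by (auto simp: random_subset_def)

lemma finite_set_random_subset: "finite I \<Longrightarrow> finite (set_pmf (random_subset I p))"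
  by (meson finite_Pow_iff finite_subset set_random_subset)

lemma integrable_random_subset [simp]:
  fixes f :: "'a set \<Rightarrow> real"
  shows "finite I \<Longrightarrow> integrable (measure_pmf (random_subset I p)) f"
  by (simp add: finite_set_random_subset integrable_measure_pmf_finite)

lemma expect_cong:
  assumes "\<And>X. X \<subseteq> I \<Longrightarrow> f X = g X"
  shows "expect I p f = expect I p g"
  using assms set_random_subset[of I p] by (intro integral_cong_AE) (auto simp: AE_measure_pmf_iff)

lemma expect_mono:
  assumes "finite I" "\<And>X. X \<subseteq> I \<Longrightarrow> f X \<le> g X"
  shows "expect I p f \<le> expect I p g"
  using assms set_random_subset[of I p] by (intro integral_mono_AE) (auto simp: AE_measure_pmf_iff)

lemma expect_sum:
  assumes "finite I"
  shows "expect I p (\<lambda>X. \<Sum>i\<in>A. f i X) = (\<Sum>i\<in>A. expect I p (f i))"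
  using assms by (intro Bochner_Integration.integral_sum) auto

lemma prob_eq_expect:
  "measure_pmf.prob (random_subset I p) {X. P X} = expect I p (\<lambda>X. of_bool (P X))"
proof -
  have "(\<lambda>X. of_bool (P X) :: real) = indicator {X. P X}"
    by (auto simp: indicator_def)
  then show ?thesis
    by simp
qed

lemma expect_bound_of_nonneg:
  assumes "finite I" "\<And>X. X \<subseteq> I \<Longrightarrow> 0 \<le> f X" "\<And>X. X \<subseteq> I \<Longrightarrow> P X \<Longrightarrow> 1 \<le> f X"
  shows "expect I p (\<lambda>X. of_bool (P X)) \<le> expect I p f"
  using assms by (intro expect_mono) auto

lemma random_subset_Un:
  assumes "finite A" "finite B" "A \<inter> B = {}"
  shows "random_subset (A \<union> B) p =
    map_pmf (\<lambda>(X, Y). X \<union> Y) (pair_pmf (random_subset A p) (random_subset B p))"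
  unfolding random_subset_def pair_map_pmf1 pair_map_pmf2 Pi_pmf_union[OF assms] map_pmf_comp
  using assms(3) by (intro map_pmf_cong) auto

lemma expectation_pair_pmf_mult:
  fixes f :: "'a \<Rightarrow> real" and g :: "'b \<Rightarrow> real"
  assumes "finite (set_pmf M)" "finite (set_pmf N)"
  shows "measure_pmf.expectation (pair_pmf M N) (\<lambda>(x, y). f x * g y) =
    measure_pmf.expectation M f * measure_pmf.expectation N g"
proof -
  have "measure_pmf.expectation (pair_pmf M N) (\<lambda>(x, y). f x * g y) =
      (\<Sum>(x,y)\<in>set_pmf M \<times> set_pmf N. (f x * g y) * pmf (pair_pmf M N) (x, y))"
    using assms by (subst integral_measure_pmf_real[where A = "set_pmf M \<times> set_pmf N"])
      (auto simp: case_prod_beta)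
  also have "\<dots> = (\<Sum>(x,y)\<in>set_pmf M \<times> set_pmf N. (f x * pmf M x) * (g y * pmf N y))"
    by (intro sum.cong) (auto simp: pmf_pair)
  also have "\<dots> = (\<Sum>x\<in>set_pmf M. f x * pmf M x) * (\<Sum>y\<in>set_pmf N. g y * pmf N y)"
    by (simp add: sum_product sum.cartesian_product)
  also have "\<dots> = measure_pmf.expectation M f * measure_pmf.expectation N g"
    using assms by (simp add: integral_measure_pmf_real[where A = "set_pmf M"]
        integral_measure_pmf_real[where A = "set_pmf N"])
  finally show ?thesis .
qed

text \<open>
  Independence of disjoint parts of the random set: \<open>f\<close> looks only at \<open>J\<close>, and \<open>g\<close> only at the
  complement of \<open>J\<close>.
\<close>

lemma expect_mult_indep:
  assumes "finite I" and f: "\<And>X. X \<subseteq> I \<Longrightarrow> f X = f (X \<inter> J)" and g: "\<And>X. X \<subseteq> I \<Longrightarrow> g X = g (X - J)"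
  shows "expect I p (\<lambda>X. f X * g X) = expect I p f * expect I p g"
proof -
  define A B where "A = I \<inter> J" and "B = I - J"
  have I: "I = A \<union> B" and fin: "finite A" "finite B" and dis: "A \<inter> B = {}"
    using assms(1) by (auto simp: A_def B_def)
  have split: "expect I p h = measure_pmf.expectation (pair_pmf (random_subset A p) (random_subset B p))
      (\<lambda>(X, Y). h (X \<union> Y))" for h :: "'a set \<Rightarrow> real"
    unfolding I random_subset_Un[OF fin dis] by (simp add: case_prod_beta')
  have ev: "measure_pmf.expectation (pair_pmf (random_subset A p) (random_subset B p))
      (\<lambda>(X, Y). h1 (X \<union> Y) * h2 (X \<union> Y)) = expect A p h1 * expect B p h2"
    if h1: "\<And>X. X \<subseteq> I \<Longrightarrow> h1 X = h1 (X \<inter> J)" and h2: "\<And>X. X \<subseteq> I \<Longrightarrow> h2 X = h2 (X - J)"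
    for h1 h2 :: "'a set \<Rightarrow> real"
  proof -
    have "measure_pmf.expectation (pair_pmf (random_subset A p) (random_subset B p))
      (\<lambda>(X, Y). h1 (X \<union> Y) * h2 (X \<union> Y)) =
      measure_pmf.expectation (pair_pmf (random_subset A p) (random_subset B p))
      (\<lambda>(X, Y). h1 X * h2 Y)"
    proof (intro integral_cong_AE, simp, simp, unfold AE_measure_pmf_iff, rule ballI)
      fix z assume "z \<in> set_pmf (pair_pmf (random_subset A p) (random_subset B p))"
      then obtain X Y where z: "z = (X, Y)" "X \<subseteq> A" "Y \<subseteq> B"
        using set_random_subset[of A p] set_random_subset[of B p] by (cases z) auto
      then have "(X \<union> Y) \<inter> J = X" "(X \<union> Y) - J = Y" "X \<union> Y \<subseteq> I"
        by (auto simp: A_def B_def)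
      then have "h1 (X \<union> Y) = h1 X" "h2 (X \<union> Y) = h2 Y"
        using h1[of "X \<union> Y"] h2[of "X \<union> Y"] by auto
      then show "(case z of (X, Y) \<Rightarrow> h1 (X \<union> Y) * h2 (X \<union> Y)) = (case z of (X, Y) \<Rightarrow> h1 X * h2 Y)"
        using z by simp
    qed
    then show ?thesis
      using fin by (simp add: expectation_pair_pmf_mult finite_set_random_subset)
  qed
  have one: "expect S p (\<lambda>_. 1) = 1" for S :: "'a set"
    by simp
  show ?thesis
    using ev[of f g, OF f g] ev[of f "\<lambda>_. 1", OF f refl] ev[of "\<lambda>_. 1" g, OF refl g]
    unfolding split by simp
qed

text \<open>
  The principle of deferred decisions. The exploration result \<open>g X\<close> can be recognised by looking only
  at the part \<open>J (g X)\<close> of \<open>X\<close>, so conditioning on \<open>g X = c\<close> leaves the part outside \<open>J c\<close> random as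
  before, and a bound that holds for every fixed outcome \<open>c\<close> in \<open>C\<close> also holds on average. Outcomes outside
  \<open>C\<close> are counted as zero.
\<close>

lemma expect_exposed_le:
  assumes fin: "finite I" and "0 \<le> \<beta>"
    and dep: "\<And>X Y. X \<subseteq> I \<Longrightarrow> Y \<subseteq> I \<Longrightarrow> Y \<inter> J (g X) = X \<inter> J (g X) \<Longrightarrow> g Y = g X"
    and f: "\<And>c X. c \<in> C \<Longrightarrow> X \<subseteq> I \<Longrightarrow> f c X = f c (X - J c)"
    and le: "\<And>c. c \<in> C \<Longrightarrow> expect I p (f c) \<le> \<beta>"
  shows "expect I p (\<lambda>X. if g X \<in> C then f (g X) X else 0) \<le> \<beta>"
proof -
  define G where "G = g ` Pow I"
  have finG: "finite G"
    using fin by (simp add: G_def)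
  have "expect I p (\<lambda>X. if g X \<in> C then f (g X) X else 0) =
      expect I p (\<lambda>X. \<Sum>c\<in>G \<inter> C. of_bool (g X = c) * f c X)"
  proof (rule expect_cong)
    fix X assume "X \<subseteq> I"
    then have "g X \<in> G"
      by (auto simp: G_def)
    moreover have "(\<Sum>c\<in>G \<inter> C. of_bool (g X = c) * f c X) = (\<Sum>c\<in>G \<inter> C. if c = g X then f c X else 0)"
      by (intro sum.cong) auto
    ultimately show "(if g X \<in> C then f (g X) X else 0) = (\<Sum>c\<in>G \<inter> C. of_bool (g X = c) * f c X)"
      using finG by (simp add: sum.delta)
  qed
  also have "\<dots> = (\<Sum>c\<in>G \<inter> C. expect I p (\<lambda>X. of_bool (g X = c) * f c X))"
    using fin by (rule expect_sum)
  also have "\<dots> = (\<Sum>c\<in>G \<inter> C. expect I p (\<lambda>X. of_bool (g X = c)) * expect I p (f c))"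
  proof (rule sum.cong[OF refl], rule expect_mult_indep[OF fin])
    fix c X assume c: "c \<in> G \<inter> C" and X: "X \<subseteq> I"
    show "f c X = f c (X - J c)"
      using c X f by auto
    have "X \<inter> J c \<subseteq> I"
      using X by auto
    then have "g (X \<inter> J c) = g X" if "g X = c \<or> g (X \<inter> J c) = c"
      using that X dep[of X "X \<inter> J c"] dep[of "X \<inter> J c" X] by (elim disjE) simp_all
    then show "(of_bool (g X = c) :: real) = of_bool (g (X \<inter> J c) = c)"
      by fastforce
  qed
  also have "\<dots> \<le> (\<Sum>c\<in>G \<inter> C. expect I p (\<lambda>X. of_bool (g X = c)) * \<beta>)"
  proof (rule sum_mono)
    fix c assume "c \<in> G \<inter> C"
    moreover have "0 \<le> expect I p (\<lambda>X. of_bool (g X = c))"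
      by (rule Bochner_Integration.integral_nonneg) simp
    ultimately show "expect I p (\<lambda>X. of_bool (g X = c)) * expect I p (f c) \<le>
        expect I p (\<lambda>X. of_bool (g X = c)) * \<beta>"
      using le by (simp add: mult_left_mono)
  qed
  also have "\<dots> = expect I p (\<lambda>X. \<Sum>c\<in>G \<inter> C. of_bool (g X = c)) * \<beta>"
    using fin by (simp add: expect_sum sum_distrib_right)
  also have "\<dots> \<le> expect I p (\<lambda>_. 1) * \<beta>"
  proof (intro mult_right_mono expect_mono fin \<open>0 \<le> \<beta>\<close>)
    fix X
    have "(\<Sum>c\<in>G \<inter> C. of_bool (g X = c)) = (\<Sum>c\<in>G \<inter> C. if c = g X then 1 else (0::real))"
      by (intro sum.cong) auto
    then show "(\<Sum>c\<in>G \<inter> C. of_bool (g X = c)) \<le> (1::real)"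
      using finG by (simp add: sum.delta)
  qed
  finally show ?thesis
    by simp
qed

lemma prob_avoid:
  assumes "finite I" "A \<subseteq> I" "0 \<le> p" "p \<le> 1"
  shows "expect I p (\<lambda>X. of_bool (X \<inter> A = {})) = (1 - p) ^ card A"
proof -
  have "expect I p (\<lambda>X. of_bool (X \<inter> A = {})) =
     measure_pmf.expectation (Pi_pmf I False (\<lambda>_. bernoulli_pmf p))
       (\<lambda>f. \<Prod>x\<in>I. if x \<in> A \<and> f x then 0 else 1)"
    unfolding random_subset_def integral_map_pmf
  proof (rule Bochner_Integration.integral_cong[OF refl])
    fix f :: "'a \<Rightarrow> bool"
    show "of_bool ({e \<in> I. f e} \<inter> A = {}) = (\<Prod>x\<in>I. if x \<in> A \<and> f x then 0 else (1::real))"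
    proof (cases "{e \<in> I. f e} \<inter> A = {}")
      case True
      then have "(\<Prod>x\<in>I. if x \<in> A \<and> f x then 0 else (1::real)) = 1"
        by (intro prod.neutral) auto
      then show ?thesis
        using True by simp
    next
      case False
      then obtain a where "a \<in> I" "a \<in> A" "f a" by auto
      then have "(\<Prod>x\<in>I. if x \<in> A \<and> f x then 0 else (1::real)) = 0"
        using assms(1) by (intro prod_zero) auto
      then show ?thesis
        using False by simp
    qed
  qed
  also have "\<dots> = (\<Prod>x\<in>I. measure_pmf.expectation (bernoulli_pmf p) (\<lambda>b. if x \<in> A \<and> b then 0 else 1))"
    using assms(1) by (intro expectation_prod_Pi_pmf)
      (auto intro!: integrable_measure_pmf_finite)
  also have "\<dots> = (\<Prod>x\<in>I. if x \<in> A then 1 - p else 1)"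
    using assms by (intro prod.cong) auto
  also have "\<dots> = (1 - p) ^ card A"
    using assms by (simp add: prod.If_cases Int_absorb1)
  finally show ?thesis .
qed

lemma prob_hit_avoid:
  assumes fin: "finite I" and A: "A \<subseteq> I" and B: "B \<subseteq> I" and dis: "A \<inter> B = {}" and p: "0 \<le> p" "p \<le> 1"
  shows "expect I p (\<lambda>X. of_bool (X \<inter> A \<noteq> {} \<and> X \<inter> B = {})) = (1 - (1 - p) ^ card A) * (1 - p) ^ card B"
proof -
  have "expect I p (\<lambda>X. of_bool (X \<inter> A \<noteq> {} \<and> X \<inter> B = {})) =
    expect I p (\<lambda>X. (1 - of_bool (X \<inter> A = {})) * of_bool (X \<inter> B = {}))"
    by (intro expect_cong) auto
  also have "\<dots> = expect I p (\<lambda>X. 1 - of_bool (X \<inter> A = {})) * expect I p (\<lambda>X. of_bool (X \<inter> B = {}))"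
  proof (intro expect_mult_indep[where J = A] fin)
    fix X :: "'a set"
    have "(X - A) \<inter> B = X \<inter> B"
      using dis by auto
    then show "of_bool (X \<inter> B = {}) = (of_bool ((X - A) \<inter> B = {}) :: real)"
      by simp
  qed (simp add: Int_assoc)
  also have "expect I p (\<lambda>X. 1 - of_bool (X \<inter> A = {})) = 1 - expect I p (\<lambda>X. of_bool (X \<inter> A = {}))"
    using fin by (subst Bochner_Integration.integral_diff) auto
  finally show ?thesis
    by (simp add: prob_avoid assms)
qed

lemma expect_card: 
  assumes "finite I" "0 \<le> p" "p \<le> 1"
  shows "expect I p (\<lambda>X. real (card X)) = real (card I) * p"
proof -
  have "expect I p (\<lambda>X. real (card X)) = expect I p (\<lambda>X. \<Sum>i\<in>I. of_bool (X \<inter> {i} \<noteq> {} \<and> X \<inter> {} = {}))"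
  proof (rule expect_cong)
    fix X assume "X \<subseteq> I"
    then have "(\<Sum>i\<in>I. of_bool (X \<inter> {i} \<noteq> {} \<and> X \<inter> {} = {})) = real (card (I \<inter> X))"
      using assms(1) by (subst card_eq_sum) (auto simp: sum.If_cases of_bool_def simp flip: sum.inter_restrict)
    then show "real (card X) = (\<Sum>i\<in>I. of_bool (X \<inter> {i} \<noteq> {} \<and> X \<inter> {} = {}))"
      using \<open>X \<subseteq> I\<close> by (simp add: Int_absorb1)
  qed
  also have "\<dots> = (\<Sum>i\<in>I. p)"
    unfolding expect_sum[OF assms(1)] using assms by (intro sum.cong refl, subst prob_hit_avoid) auto
  finally show ?thesis by simp
qed

section \<open>Balls, distances and certificates\<close>

text \<open>
  The set \<open>reached E x i\<close> consists of the vertices at distance strictly less than \<open>i\<close> from \<open>x\<close>. With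
  the strict inequality the ball of radius \<open>k - 2\<close>, which is empty for \<open>k = 1\<close>, is an instance.
\<close>

primrec reached :: "nat set set \<Rightarrow> nat \<Rightarrow> nat \<Rightarrow> nat set" where
  "reached E x 0 = {}"
| "reached E x (Suc i) = insert x (reached E x i \<union> {y. \<exists>a\<in>reached E x i. {a, y} \<in> E})"

lemma reached_mono: "i \<le> j \<Longrightarrow> reached E x i \<subseteq> reached E x j"
  by (rule lift_Suc_mono_le) auto

lemma reached_mono_edges: "E \<subseteq> F \<Longrightarrow> reached E x i \<subseteq> reached F x i"
  by (induction i) auto

lemma reached_self: "0 < i \<Longrightarrow> x \<in> reached E x i"
  by (cases i) auto

lemma reached_via_edge: "{x, y} \<in> E \<Longrightarrow> reached E y i \<subseteq> reached E x (Suc i)"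
proof (induction i)
  case (Suc i)
  have "y \<in> reached E x (Suc (Suc i))"
    using Suc.prems by auto
  then show ?case
    using Suc by (auto simp del: reached.simps(2)) (auto simp: subset_iff)
qed simp

lemma reached_subset:
  assumes "E \<subseteq> nsets V 2" "x \<in> V"
  shows "reached E x i \<subseteq> V"
  using assms by (induction i) (auto simp: subset_iff nsets_def)

lemma reached_imp_path:
  "y \<in> reached E x i \<Longrightarrow> \<exists>vs. path_between E x y vs \<and> length vs \<le> i"
proof (induction i arbitrary: y)
  case (Suc i)
  consider "y = x" | "y \<in> reached E x i" | a where "a \<in> reached E x i" "{a, y} \<in> E"
    using Suc.prems by auto
  then show ?case
  proof cases
    case 1
    then have "path_between E x y [x]"
      by (simp add: path_between_def)
    then show ?thesis
      by force
  next
    case 2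
    then show ?thesis
      using Suc.IH le_SucI by blast
  next
    case 3
    then obtain vs where vs: "path_between E x a vs" "length vs \<le> i"
      using Suc.IH by blast
    show ?thesis
    proof (cases "y \<in> set vs")
      case True
      then obtain ps qs where pq: "vs = ps @ y # qs"
        by (meson split_list)
      then have "vs = (ps @ [y]) @ qs"
        by simp
      then have "successively (\<lambda>u v. {u, v} \<in> E) (ps @ [y])" "distinct (ps @ [y])"
        using vs(1) unfolding path_between_def by (metis successively_append_iff, metis distinct_append)
      moreover have "hd (ps @ [y]) = x"
        using vs(1) pq unfolding path_between_def by (cases ps) auto
      ultimately have "path_between E x y (ps @ [y])"
        by (simp add: path_between_def)
      then show ?thesis
        using pq vs(2) by (intro exI[of _ "ps @ [y]"]) auto
    next
      case False
      then have "path_between E x y (vs @ [y])"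
        using vs(1) 3(2) by (auto simp: path_between_def successively_append_iff)
      then show ?thesis
        using vs(2) by (intro exI[of _ "vs @ [y]"]) auto
    qed
  qed
qed simp

lemma path_imp_reached: "path_between E x y vs \<Longrightarrow> y \<in> reached E x (length vs)"
proof (induction vs arbitrary: y rule: rev_induct)
  case (snoc z vs)
  show ?case
  proof (cases "vs = []")
    case False
    then have "path_between E x (last vs) vs" "{last vs, y} \<in> E"
      using snoc.prems by (auto simp: path_between_def successively_append_iff)
    then show ?thesis
      using snoc.IH by auto
  qed (use snoc.prems in \<open>auto simp: path_between_def\<close>)
qed (simp add: path_between_def)

lemma reached_iff_graph_dist: "y \<in> reached E x i \<longleftrightarrow> graph_dist E x y < enat i"
proof -
  have "graph_dist E x y < enat i \<longleftrightarrow> (\<exists>vs. path_between E x y vs \<and> length vs \<le> i)"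
    unfolding graph_dist_def INF_less_iff
    by (auto simp: path_between_def Suc_le_eq) (metis Suc_pred length_greater_0_conv not_less_eq not_less Suc_le_eq)+
  also have "\<dots> \<longleftrightarrow> y \<in> reached E x i"
    using reached_imp_path path_imp_reached reached_mono by blast
  finally show ?thesis ..
qed

declare reached.simps(2) [simp del]

text \<open>
  The breadth-first search up to the next layer only inspects edges that touch a vertex reached so far.
\<close>

lemma reached_exposed:
  assumes "\<And>e. e \<inter> reached E x i \<noteq> {} \<Longrightarrow> e \<in> F \<longleftrightarrow> e \<in> E" "j \<le> Suc i"
  shows "reached F x j = reached E x j"
  using assms(2)
proof (induction j)
  case (Suc j)
  then have "reached F x j = reached E x j" "reached E x j \<subseteq> reached E x i"
    using reached_mono by auto
  then have "(\<exists>a\<in>reached F x j. {a, y} \<in> F) \<longleftrightarrow> (\<exists>a\<in>reached E x j. {a, y} \<in> E)" for y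
    using assms(1)[of "{_, y}"] by blast
  then show ?case
    using \<open>reached F x j = reached E x j\<close> by (simp add: reached.simps(2))
qed simp

definition neighbours :: "nat set set \<Rightarrow> nat \<Rightarrow> nat set" where
  "neighbours E x = {y. {x, y} \<in> E}"

text \<open>
  Layers, unlike balls, are bounded by \<open>\<Delta> ^ i\<close> without a constant factor. This matters because the
  bound for the outermost layer around \<open>v\<close> enters an exponent.
\<close>

lemma card_layer_le:
  assumes E: "E \<subseteq> nsets V 2" and V: "finite V" and x: "x \<in> V"
    and deg: "\<And>y. y \<in> V \<Longrightarrow> real (card (neighbours E y)) \<le> \<Delta>"
  shows "real (card (reached E x (Suc i) - reached E x i)) \<le> \<Delta> ^ i"
proof (induction i)
  case (Suc i)
  define L where "L = reached E x (Suc i) - reached E x i"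
  have L: "L \<subseteq> V" "finite L"
    using reached_subset[OF E x] V finite_subset unfolding L_def by blast+
  have "reached E x (Suc (Suc i)) - reached E x (Suc i) \<subseteq> (\<Union>a\<in>L. neighbours E a)"
  proof
    fix y assume "y \<in> reached E x (Suc (Suc i)) - reached E x (Suc i)"
    then obtain a where a: "a \<in> reached E x (Suc i)" "{a, y} \<in> E" and y: "y \<notin> reached E x (Suc i)"
      using reached_self[of "Suc i" x E] unfolding reached.simps(2)[of E x "Suc i"] by blast
    then have "a \<notin> reached E x i"
      by (auto simp: reached.simps(2)[of E x i])
    then show "y \<in> (\<Union>a\<in>L. neighbours E a)"
      using a by (auto simp: L_def neighbours_def)
  qed
  moreover have fin: "finite (neighbours E a)" for a
    using E V by (intro finite_subset[of "neighbours E a" V]) (auto simp: neighbours_def nsets_def)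
  ultimately have "card (reached E x (Suc (Suc i)) - reached E x (Suc i)) \<le> card (\<Union>a\<in>L. neighbours E a)"
    using L by (intro card_mono) auto
  also have "\<dots> \<le> (\<Sum>a\<in>L. card (neighbours E a))"
    using L by (intro card_UN_le)
  finally have "real (card (reached E x (Suc (Suc i)) - reached E x (Suc i))) \<le>
      (\<Sum>a\<in>L. real (card (neighbours E a)))"
    by (simp flip: of_nat_sum)
  also have "\<dots> \<le> real (card L) * \<Delta>"
    using L deg by (intro sum_bounded_above) auto
  also have "\<dots> \<le> \<Delta> ^ i * \<Delta>"
  proof (rule mult_right_mono)
    show "0 \<le> \<Delta>"
      using deg[OF x] by linarith
  qed (use Suc.IH in \<open>simp add: L_def\<close>)
  finally show ?case
    by (simp add: mult.commute)
qed (simp add: reached.simps(2))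

lemma card_reached_le:
  assumes "E \<subseteq> nsets V 2" "finite V" "x \<in> V"
    and "\<And>y. y \<in> V \<Longrightarrow> real (card (neighbours E y)) \<le> \<Delta>" and "2 \<le> \<Delta>"
  shows "real (card (reached E x (Suc i))) \<le> 2 * \<Delta> ^ i"
proof (induction i)
  case (Suc i)
  have "finite (reached E x m)" for m
    using reached_subset[OF assms(1,3)] assms(2) finite_subset by blast
  then have "card (reached E x (Suc (Suc i))) =
      card (reached E x (Suc i)) + card (reached E x (Suc (Suc i)) - reached E x (Suc i))"
    by (subst card_Un_disjoint[symmetric])
      (auto intro!: arg_cong[where f = card] simp: Un_absorb1 reached_mono)
  then have "real (card (reached E x (Suc (Suc i)))) \<le> 2 * \<Delta> ^ i + \<Delta> ^ Suc i"
    using Suc card_layer_le[OF assms(1-4), of "Suc i"] by simp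
  also have "\<dots> \<le> 2 * \<Delta> ^ Suc i"
    using assms(5) by (simp add: mult_right_mono)
  finally show ?case .
qed (simp add: reached.simps(2))

text \<open>
  If \<open>C\<close> is disjoint from \<open>M\<close> and \<open>K\<close>, then membership of different vertices of \<open>C\<close> depends on
  disjoint sets of pairs. All random quantities below are cardinalities of such sets: degrees and
  neighbourhoods of sets (with \<open>K = {}\<close>) and the set of certifying vertices.
\<close>

definition joined :: "nat set set \<Rightarrow> nat set \<Rightarrow> nat set \<Rightarrow> nat set \<Rightarrow> nat set" where
  "joined E M K C = {s \<in> C. (\<exists>a\<in>M. {s, a} \<in> E) \<and> (\<forall>b\<in>K. {s, b} \<notin> E)}"

lemma joined_minus:
  assumes "\<And>s a. s \<in> C \<Longrightarrow> a \<in> M \<union> K \<Longrightarrow> {s, a} \<notin> J"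
  shows "joined (E - J) M K C = joined E M K C"
  using assms by (auto simp: joined_def)

definition pairs_meeting :: "nat \<Rightarrow> nat set \<Rightarrow> nat set set" where
  "pairs_meeting n S = {e \<in> nsets {1..n} 2. e \<inter> S \<noteq> {}}"

lemma card_pairs_meeting:
  assumes "finite S"
  shows "card (pairs_meeting n S) \<le> card S * n"
proof -
  have "pairs_meeting n S \<subseteq> (\<lambda>(s, x). {s, x}) ` (S \<times> {1..n})"
  proof
    fix e assume "e \<in> pairs_meeting n S"
    then have "e \<in> nsets {1..n} 2" "e \<inter> S \<noteq> {}"
      by (simp_all add: pairs_meeting_def)
    moreover from this(1) obtain x y where "e = {x, y}" "x \<in> {1..n}" "y \<in> {1..n}"
      by (rule nsets2_E)
    ultimately have xy: "e = {x, y}" "x \<in> {1..n}" "y \<in> {1..n}" "x \<in> S \<or> y \<in> S"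
      by auto
    then have "e = (\<lambda>(s, x). {s, x}) (x, y)" "e = (\<lambda>(s, x). {s, x}) (y, x)"
      by (auto simp: insert_commute)
    then show "e \<in> (\<lambda>(s, x). {s, x}) ` (S \<times> {1..n})"
      using xy by blast
  qed
  then have "card (pairs_meeting n S) \<le> card (S \<times> {1..n})"
    using assms by (meson card_image_le card_mono finite_SigmaI finite_atLeastAtMost finite_imageI le_trans)
  then show ?thesis
    by (simp add: card_cartesian_product)
qed

text \<open>
  Since all pairs at \<open>s \<in> S\<close> are queried, \<open>E'\<close> and \<open>E\<close> agree on the balls around \<open>s\<close>. First
  \<open>E' \<subseteq> E\<close>: an additional edge \<open>uv\<close> of \<open>E'\<close> would join vertices whose distances from \<open>s\<close> differ by at
  least two. Given this inclusion, \<open>E'\<close> cannot lack an edge \<open>uv\<close> of \<open>E\<close>, since without it \<open>v\<close> is at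
  distance at least \<open>k + 2\<close> from \<open>s\<close>, but it is at distance at most \<open>k + 1\<close> in \<open>E\<close>.
\<close>

lemma reconstructible_if_certified:
  assumes E: "E \<subseteq> nsets {1..n} 2"
    and cert: "\<And>u v. u \<in> {1..n} \<Longrightarrow> v \<in> {1..n} \<Longrightarrow> u \<noteq> v \<Longrightarrow>
      \<exists>s\<in>S \<inter> {1..n}. s \<noteq> u \<and> s \<in> reached (E - {{u, v}}) u (Suc k) \<and> s \<notin> reached (E - {{u, v}}) v (Suc (Suc k))"
  shows "reconstructible n (pairs_meeting n S) E"
  unfolding reconstructible_def
proof (intro allI impI)
  fix E' assume E': "E' \<subseteq> nsets {1..n} 2"
    and "\<forall>x y. {x, y} \<in> pairs_meeting n S \<longrightarrow> graph_dist E' x y = graph_dist E x y"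
  then have eq: "s \<in> reached E' x i \<longleftrightarrow> s \<in> reached E x i"
    if "s \<in> S \<inter> {1..n}" "x \<in> {1..n}" "s \<noteq> x" for s x i
    using that by (auto simp: reached_iff_graph_dist pairs_meeting_def)
  have sub: "E' \<subseteq> E"
  proof
    fix e assume e: "e \<in> E'"
    show "e \<in> E"
    proof (rule ccontr)
      assume nE: "e \<notin> E"
      obtain u v where uv: "e = {u, v}" "u \<in> {1..n}" "v \<in> {1..n}" "u \<noteq> v"
        using e E' by (meson nsets2_E subsetD)
      have "E - {{u, v}} = E"
        using nE uv by auto
      then obtain s where s: "s \<in> S \<inter> {1..n}" "s \<noteq> u" "s \<in> reached E u (Suc k)" "s \<notin> reached E v (Suc (Suc k))"
        using cert[OF uv(2-4)] by metis
      have "s \<noteq> v"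
        using s(4) reached_self[of "Suc (Suc k)" v E] by blast
      have "s \<in> reached E' u (Suc k)"
        using s eq uv by blast
      moreover have "{v, u} \<in> E'"
        using e uv(1) by (simp add: insert_commute)
      ultimately have "s \<in> reached E' v (Suc (Suc k))"
        using reached_via_edge by blast
      then show False
        using s eq uv \<open>s \<noteq> v\<close> by blast
    qed
  qed
  have "E \<subseteq> E'"
  proof
    fix e assume e: "e \<in> E"
    show "e \<in> E'"
    proof (rule ccontr)
      assume nE: "e \<notin> E'"
      obtain u v where uv: "e = {u, v}" "u \<in> {1..n}" "v \<in> {1..n}" "u \<noteq> v"
        using e E by (meson nsets2_E subsetD)
      define H where "H = E - {{u, v}}"
      obtain s where s: "s \<in> S \<inter> {1..n}" "s \<noteq> u" "s \<in> reached H u (Suc k)" "s \<notin> reached H v (Suc (Suc k))"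
        using cert[OF uv(2-4)] unfolding H_def by blast
      have "s \<noteq> v"
        using s(4) reached_self[of "Suc (Suc k)" v H] by blast
      have "E' \<subseteq> H" "H \<subseteq> E"
        using sub nE uv by (auto simp: H_def)
      have "s \<in> reached E u (Suc k)"
        using s(3) reached_mono_edges[OF \<open>H \<subseteq> E\<close>] by blast
      moreover have "{v, u} \<in> E"
        using e uv(1) by (simp add: insert_commute)
      ultimately have "s \<in> reached E v (Suc (Suc k))"
        using reached_via_edge by blast
      then have "s \<in> reached E' v (Suc (Suc k))"
        using s eq uv \<open>s \<noteq> v\<close> by blast
      then show False
        using s(4) reached_mono_edges[OF \<open>E' \<subseteq> H\<close>] by blast
    qed
  qed
  with sub show "E' = E"
    by (rule equalityI)
qed

lemma reconstructible_all_pairs: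
  assumes "E \<subseteq> nsets {1..n} 2"
  shows "reconstructible n (nsets {1..n} 2) E"
  unfolding reconstructible_def
proof (intro allI impI)
  fix E' assume E': "E' \<subseteq> nsets {1..n} 2"
    and eq: "\<forall>x y. {x, y} \<in> nsets {1..n} 2 \<longrightarrow> graph_dist E' x y = graph_dist E x y"
  have edge: "{u, v} \<in> F \<longleftrightarrow> v \<in> reached F u 2" if "u \<noteq> v" for u v :: nat and F
    using that by (auto simp: numeral_2_eq_2 reached.simps(2))
  have "{u, v} \<in> E' \<longleftrightarrow> {u, v} \<in> E" if "{u, v} \<in> nsets {1..n} 2" for u v
    using that eq by (auto simp: edge reached_iff_graph_dist)
  then show "E' = E"
    using E' assms by (metis (no_types, lifting) nsets2_E subsetD subsetI subset_antisym)
qed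

text \<open>
  The outcome of the exploration for the pair \<open>u\<close>, \<open>v\<close> and \<open>k = Suc j\<close>: the balls around \<open>u\<close> of radius
  \<open>k - 2\<close> and \<open>k - 1\<close>, and those around \<open>v\<close> of radius \<open>k - 1\<close> and \<open>k\<close>. They are computed without the
  pair \<open>uv\<close>, so that edges and non-edges are treated in the same way. In the following definitions
  \<open>Z'\<close>, \<open>Z\<close> are the balls around \<open>u\<close> and \<open>W'\<close>, \<open>W\<close> those around \<open>v\<close>.
\<close>

definition exploration :: "nat set set \<Rightarrow> nat \<Rightarrow> nat \<Rightarrow> nat \<Rightarrow> (nat set \<times> nat set) \<times> nat set \<times> nat set" where
  "exploration E u v j = (let H = E - {{u, v}} in
     ((reached H u j, reached H u (Suc j)), (reached H v (Suc j), reached H v (Suc (Suc j)))))"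

text \<open>
  The vertices of the last layer around \<open>u\<close> that are far from \<open>v\<close>. A fresh vertex joined to one of
  them is at distance \<open>k\<close> from \<open>u\<close>. In this and the next two sets, \<open>Z'\<close> and \<open>W'\<close> are removed even where
  inclusions between balls would imply it: the pairs between these sets are then unexplored for
  arbitrary quadruples, not only for outcomes of an exploration.
\<close>

definition goal_set :: "(nat set \<times> nat set) \<times> nat set \<times> nat set \<Rightarrow> nat set" where
  "goal_set = (\<lambda>((Z', Z), (W', W)). Z - Z' - W - W')"

text \<open>
  The vertices of the last layer around \<open>v\<close> whose pairs with fresh vertices are unexplored. A fresh vertex joined to
  none of them is at distance greater than \<open>k + 1\<close> from \<open>v\<close>.
\<close>

definition block_set :: "(nat set \<times> nat set) \<times> nat set \<times> nat set \<Rightarrow> nat set" where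
  "block_set = (\<lambda>((Z', Z), (W', W)). W - W' - Z')"

definition fresh_set :: "nat set \<Rightarrow> (nat set \<times> nat set) \<times> nat set \<times> nat set \<Rightarrow> nat set" where
  "fresh_set V = (\<lambda>((Z', Z), (W', W)). V - Z - W - Z' - W')"

definition explored_edges :: "(nat set \<times> nat set) \<times> nat set \<times> nat set \<Rightarrow> nat set set" where
  "explored_edges = (\<lambda>((Z', Z), (W', W)). {e. e \<inter> (Z' \<union> W') \<noteq> {}})"

definition witnesses ::
  "nat set \<Rightarrow> (nat set \<times> nat set) \<times> nat set \<times> nat set \<Rightarrow> nat set set \<Rightarrow> nat set" where
  "witnesses V c E = joined E (goal_set c) (block_set c) (fresh_set V c)"

text \<open>
  A fresh vertex has no neighbour in the inner balls, as it would otherwise lie in one of the outer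
  balls. So its distance from \<open>v\<close> is decided by the block set alone.
\<close>

lemma witness_certifies:
  assumes "s \<in> witnesses V (exploration E u v j) E"
  shows "s \<in> V" "s \<noteq> u" "s \<in> reached (E - {{u, v}}) u (Suc (Suc j))"
    "s \<notin> reached (E - {{u, v}}) v (Suc (Suc (Suc j)))"
proof -
  define H where "H = E - {{u, v}}"
  note defs = witnesses_def joined_def goal_set_def block_set_def fresh_set_def exploration_def Let_def
  obtain a where s: "s \<in> V" "s \<notin> reached H u (Suc j)" "s \<notin> reached H v (Suc (Suc j))"
    and a: "a \<in> reached H u (Suc j)" "{s, a} \<in> E"
    and b: "\<And>b. b \<in> reached H v (Suc (Suc j)) - reached H v (Suc j) - reached H u j \<Longrightarrow> {s, b} \<notin> E"
    using assms unfolding defs H_def[symmetric] split_conv by blast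
  have ne: "s \<noteq> u" "s \<noteq> v"
    using s reached_self[of "Suc j" u H] reached_self[of "Suc (Suc j)" v H] by blast+
  show "s \<in> V" "s \<noteq> u"
    by fact+
  have "{a, s} \<in> H"
    using a ne by (auto simp: H_def insert_commute doubleton_eq_iff)
  then show "s \<in> reached (E - {{u, v}}) u (Suc (Suc j))"
    using a(1) unfolding H_def[symmetric] reached.simps(2)[of _ _ "Suc j"] by blast
  show "s \<notin> reached (E - {{u, v}}) v (Suc (Suc (Suc j)))"
  proof
    assume "s \<in> reached (E - {{u, v}}) v (Suc (Suc (Suc j)))"
    then obtain b' where b': "b' \<in> reached H v (Suc (Suc j))" "{b', s} \<in> H"
      using s ne unfolding H_def[symmetric] reached.simps(2)[of _ _ "Suc (Suc j)"] by blast
    have "b' \<notin> reached H v (Suc j)"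
      using s(3) b'(2) by (auto simp: reached.simps(2)[of H v "Suc j"])
    moreover have "b' \<notin> reached H u j"
      using s(2) b'(2) by (auto simp: reached.simps(2)[of H u j])
    ultimately show False
      using b b' by (auto simp: H_def insert_commute)
  qed
qed

text \<open>
  With the next lemma, this makes the exploration and the witnesses an instance of
  \<open>expect_exposed_le\<close>.
\<close>

lemma exploration_exposed:
  assumes "Y \<inter> explored_edges (exploration X u v j) = X \<inter> explored_edges (exploration X u v j)"
  shows "exploration Y u v j = exploration X u v j"
proof -
  have same: "e \<in> Y - {{u, v}} \<longleftrightarrow> e \<in> X - {{u, v}}"
    if "e \<inter> reached (X - {{u, v}}) u j \<noteq> {} \<or> e \<inter> reached (X - {{u, v}}) v (Suc j) \<noteq> {}" for e
    using assms that by (auto simp: explored_edges_def exploration_def Let_def set_eq_iff)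
  have "reached (Y - {{u, v}}) u i = reached (X - {{u, v}}) u i" if "i \<le> Suc j" for i
    using same that by (intro reached_exposed[where i = j]) auto
  moreover have "reached (Y - {{u, v}}) v i = reached (X - {{u, v}}) v i" if "i \<le> Suc (Suc j)" for i
    using same that by (intro reached_exposed[where i = "Suc j"]) (auto)
  ultimately show ?thesis
    by (simp add: exploration_def Let_def)
qed

lemma witnesses_unexplored:
  "witnesses V c (E - explored_edges c) = witnesses V c E"
  unfolding witnesses_def
  by (rule joined_minus) (auto simp: goal_set_def block_set_def fresh_set_def explored_edges_def)

text \<open>
  A path from \<open>v\<close> through \<open>u\<close> that avoids the edge \<open>uv\<close> spends at least two steps before it reaches
  \<open>u\<close>. Hence the ball around \<open>v\<close> may be explored without the vertex \<open>u\<close>: this loses only vertices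
  that are close to \<open>u\<close>, and these do not belong to the last layer around \<open>u\<close>.
\<close>

lemma reached_without_vertex:
  assumes "u \<noteq> v"
  shows "reached (E - {{u, v}}) v (Suc (Suc i)) \<subseteq>
    reached {e \<in> E. u \<notin> e} v (Suc (Suc i)) \<union> reached (E - {{u, v}}) u i"
proof (induction i)
  case 0
  show ?case
    using assms by (auto simp: insert_commute reached.simps(2))
next
  case (Suc i)
  define H where "H = E - {{u, v}}"
  define F where "F = {e \<in> E. u \<notin> e}"
  have uF: "u \<notin> reached F v m" for m
    using assms by (induction m) (auto simp: F_def reached.simps(2))
  show ?case
  proof
    fix y assume "y \<in> reached (E - {{u, v}}) v (Suc (Suc (Suc i)))"
    then consider "y = v" | "y \<in> reached H v (Suc (Suc i))"
      | a where "a \<in> reached H v (Suc (Suc i))" "{a, y} \<in> H"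
      unfolding H_def[symmetric] reached.simps(2)[of _ _ "Suc (Suc i)"] by blast
    then have "y \<in> reached F v (Suc (Suc (Suc i))) \<or> y \<in> reached H u (Suc i)"
    proof cases
      case 1
      then show ?thesis by (simp add: reached_self)
    next
      case 2
      then show ?thesis
        using Suc reached_mono[of "Suc (Suc i)" "Suc (Suc (Suc i))" F v] reached_mono[of i "Suc i" H u]
        unfolding H_def[symmetric] F_def[symmetric] by auto
    next
      case 3
      show ?thesis
      proof (cases "a \<in> reached H u i \<or> y = u")
        case True
        then show ?thesis using 3 by (auto simp: reached_self reached.simps(2)[of H u i])
      next
        case False
        then have a: "a \<in> reached F v (Suc (Suc i))"
          using 3 Suc unfolding H_def[symmetric] F_def[symmetric] by auto
        then have "{a, y} \<in> F"
          using False 3 uF[of "Suc (Suc i)"] by (auto simp: F_def H_def)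
        then show ?thesis
          using a unfolding reached.simps(2)[of _ _ "Suc (Suc i)"] by blast
      qed
    qed
    then show "y \<in> reached {e \<in> E. u \<notin> e} v (Suc (Suc (Suc i))) \<union> reached (E - {{u, v}}) u (Suc i)"
      unfolding H_def F_def by blast
  qed
qed

definition expands :: "nat set set \<Rightarrow> nat set \<Rightarrow> nat \<Rightarrow> real \<Rightarrow> real \<Rightarrow> bool" where
  "expands E R u \<nu> a \<longleftrightarrow> (\<forall>A\<subseteq>R. A \<noteq> {} \<longrightarrow> real (card A) \<le> a \<longrightarrow>
     \<nu> * real (card A) \<le> real (card (joined E A {} (R - {u} - A))))"

text \<open>
  Let \<open>B\<close> be the ball around \<open>v\<close> in the graph without \<open>u\<close>. Outside \<open>B\<close> each layer around \<open>u\<close>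
  expands by the factor \<open>\<nu>\<close>, and the new vertices that were reached earlier, possibly by shortcuts
  through \<open>B\<close>, are at most \<open>2 * \<Delta> ^ i\<close>. The margin between \<open>\<nu>\<close> and \<open>g\<close> absorbs this loss.
\<close>

lemma card_goal_set_ge:
  assumes E: "E \<subseteq> nsets V 2" and V: "finite V" and uv: "u \<in> V" "v \<in> V" "u \<noteq> v"
    and deg: "\<And>y. y \<in> V \<Longrightarrow> real (card (neighbours E y)) \<le> \<Delta>" and \<Delta>: "2 \<le> \<Delta>"
    and exp: "expands E (V - reached {e \<in> E. u \<notin> e} v (Suc (Suc j))) u \<nu> (\<Delta> ^ j)"
    and g: "0 < g" and step: "\<And>i. i < j \<Longrightarrow> 2 * \<Delta> ^ i \<le> (\<nu> - g) * g ^ i" and \<nu>: "0 \<le> \<nu>"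
  shows "g ^ j \<le> real (card (goal_set (exploration E u v j)))"
proof -
  define H where "H = E - {{u, v}}"
  define B where "B = reached {e \<in> E. u \<notin> e} v (Suc (Suc j))"
  define L where "L i = reached H u (Suc i) - reached H u i - B" for i
  have H: "H \<subseteq> nsets V 2"
    using E by (auto simp: H_def)
  have fin: "finite (reached H x i)" if "x \<in> V" for x i
    using reached_subset[OF H that] V finite_subset by blast
  have degH: "real (card (neighbours H y)) \<le> \<Delta>" if "y \<in> V" for y
  proof -
    have "finite (neighbours E y)"
      using E V by (intro finite_subset[of "neighbours E y" V]) (auto simp: neighbours_def nsets_def)
    then have "card (neighbours H y) \<le> card (neighbours E y)"
      by (intro card_mono) (auto simp: neighbours_def H_def)
    then show ?thesis
      using deg[OF that] by linarith
  qed
  have finL: "finite (L i)" for i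
    using fin[OF uv(1)] by (simp add: L_def)
  have LV: "L i \<subseteq> V - B" for i
    using reached_subset[OF H uv(1), of "Suc i"] by (auto simp: L_def)
  have cardL: "real (card (L i)) \<le> \<Delta> ^ i" for i
  proof -
    have "card (L i) \<le> card (reached H u (Suc i) - reached H u i)"
      using fin[OF uv(1)] by (intro card_mono) (auto simp: L_def)
    then show ?thesis
      using card_layer_le[OF H V uv(1) degH, of i] by simp
  qed
  have uB: "u \<notin> reached {e \<in> E. u \<notin> e} v m" for m
    using uv(3) by (induction m) (auto simp: reached.simps(2))
  have "g ^ i \<le> real (card (L i))" if "i \<le> j" for i
    using that
  proof (induction i)
    case 0
    have "L 0 = {u}"
      using uB[of "Suc (Suc j)"] by (auto simp: L_def B_def reached.simps(2)[of H u 0])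
    then show ?case by simp
  next
    case (Suc i)
    then have IH: "g ^ i \<le> real (card (L i))" and i: "i < j"
      by auto
    have "L i \<noteq> {}"
      using IH g by (metis card.empty of_nat_0 not_less zero_less_power)
    moreover have "real (card (L i)) \<le> \<Delta> ^ j"
      using cardL[of i] power_increasing[of i j \<Delta>] i \<Delta> by linarith
    ultimately have "\<nu> * real (card (L i)) \<le> real (card (joined E (L i) {} (V - B - {u} - L i)))"
      using exp LV unfolding expands_def B_def by blast
    also have "card (joined E (L i) {} (V - B - {u} - L i)) \<le> card (L (Suc i) \<union> reached H u (Suc i))"
    proof (rule card_mono)
      show "joined E (L i) {} (V - B - {u} - L i) \<subseteq> L (Suc i) \<union> reached H u (Suc i)"
      proof
        fix s assume "s \<in> joined E (L i) {} (V - B - {u} - L i)"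
        then obtain a where s: "s \<notin> B" "s \<noteq> u" "a \<in> L i" "{s, a} \<in> E"
          by (auto simp: joined_def)
        have "s \<noteq> v"
          using s(1) reached_self[of "Suc (Suc j)" v] unfolding B_def by blast
        then have "{a, s} \<in> H"
          using s by (auto simp: H_def insert_commute doubleton_eq_iff)
        then have "s \<in> reached H u (Suc (Suc i))"
          using s(3) unfolding L_def reached.simps(2)[of _ _ "Suc i"] by blast
        then show "s \<in> L (Suc i) \<union> reached H u (Suc i)"
          using s(1) unfolding L_def by blast
      qed
    qed (use finL fin[OF uv(1)] in simp)
    also have "card (L (Suc i) \<union> reached H u (Suc i)) \<le> card (L (Suc i)) + card (reached H u (Suc i))"
      by (rule card_Un_le)
    finally have "\<nu> * real (card (L i)) \<le> real (card (L (Suc i))) + real (card (reached H u (Suc i)))"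
      by simp
    moreover have "real (card (reached H u (Suc i))) \<le> 2 * \<Delta> ^ i"
      by (rule card_reached_le[OF H V uv(1) degH \<Delta>])
    moreover have "\<nu> * g ^ i \<le> \<nu> * real (card (L i))"
      using IH \<nu> by (rule mult_left_mono)
    moreover have "2 * \<Delta> ^ i \<le> \<nu> * g ^ i - g * g ^ i"
      using step[OF i] by (simp add: left_diff_distrib)
    ultimately show ?case
      by simp
  qed
  then have "g ^ j \<le> real (card (L j))"
    by simp
  also have "card (L j) \<le> card (goal_set (exploration E u v j))"
  proof (rule card_mono)
    show "L j \<subseteq> goal_set (exploration E u v j)"
      using reached_without_vertex[OF uv(3), where E = E and i = j] reached_mono[of "Suc j" "Suc (Suc j)" H v]
      by (auto simp: goal_set_def exploration_def Let_def L_def B_def H_def)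
    show "finite (goal_set (exploration E u v j))"
      using fin[OF uv(1)] by (simp add: goal_set_def exploration_def Let_def H_def)
  qed
  finally show ?thesis
    by simp
qed

section \<open>Probability estimates for a fixed pair of vertices\<close>

lemma one_minus_power_le_exp:
  fixes x :: real
  assumes "0 \<le> x" "x \<le> 1"
  shows "(1 - x) ^ m \<le> exp (- (real m * x))"
proof -
  have "(1 - x) ^ m \<le> exp (- x) ^ m"
    using assms exp_ge_add_one_self[of "- x"] by (intro power_mono) auto
  then show ?thesis
    by (simp flip: exp_of_nat_mult)
qed

lemma one_minus_exp_ge:
  fixes x :: real
  assumes "0 \<le> x"
  shows "x - x\<^sup>2 \<le> 1 - exp (- x)"
proof -
  have "exp (- x) \<le> inverse (1 + x)"
    using assms by (subst exp_minus) (intro le_imp_inverse_le exp_ge_add_one_self, simp)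
  also have "\<dots> \<le> 1 - x + x\<^sup>2"
  proof -
    have "1 \<le> (1 + x) * (1 - x + x\<^sup>2)"
      using assms by (simp add: algebra_simps power2_eq_square)
    then show ?thesis
      using assms by (simp add: field_simps)
  qed
  finally show ?thesis
    by simp
qed

lemma hit_probability_bounds:
  fixes p :: real
  assumes "0 \<le> p" "p \<le> 1"
  shows "0 \<le> (1 - (1 - p) ^ a) * (1 - p) ^ b" "(1 - (1 - p) ^ a) * (1 - p) ^ b \<le> 1"
proof -
  have "(1 - p) ^ a \<le> 1" "(1 - p) ^ b \<le> 1" "0 \<le> (1 - p) ^ a" "0 \<le> (1 - p) ^ b"
    using assms by (auto intro: power_le_one)
  then show "0 \<le> (1 - (1 - p) ^ a) * (1 - p) ^ b" "(1 - (1 - p) ^ a) * (1 - p) ^ b \<le> 1"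
    by (auto intro: mult_le_one)
qed

text \<open>
  The cardinality is binomially distributed with \<open>card C\<close> trials. Its probability generating function
  gives both the tail bounds for degrees and neighbourhoods and, with \<open>z = 1 - r\<close>, the probability
  that a random vertex set of density \<open>r\<close> contains no witness.
\<close>

lemma expect_power_card_joined:
  assumes V: "finite V" "M \<subseteq> V" "K \<subseteq> V" "C \<subseteq> V" and dis: "M \<inter> K = {}" "C \<inter> M = {}" "C \<inter> K = {}"
    and p: "0 \<le> p" "p \<le> 1"
  shows "expect (nsets V 2) p (\<lambda>E. z ^ card (joined E M K C)) =
    (1 - (1 - (1 - p) ^ card M) * (1 - p) ^ card K * (1 - z)) ^ card C"
proof -
  define \<rho> where "\<rho> = (1 - (1 - p) ^ card M) * (1 - p) ^ card K"
  have "finite C"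
    using V(1,4) by (rule rev_finite_subset)
  have fin: "finite (nsets V 2)"
    using V(1) by (rule finite_imp_finite_nsets)
  show ?thesis
    using \<open>finite C\<close> V(4) dis(2,3)
  proof (induction C rule: finite_induct)
    case empty
    show ?case
      by (simp add: joined_def)
  next
    case (insert s C)
    define A where "A = (\<lambda>a. {s, a}) ` M"
    define B where "B = (\<lambda>a. {s, a}) ` K"
    define h where "h E \<longleftrightarrow> E \<inter> A \<noteq> {} \<and> E \<inter> B = {}" for E
    have sV: "s \<in> V" "s \<notin> M" "s \<notin> K"
      using insert by auto
    have sub: "A \<subseteq> nsets V 2" "B \<subseteq> nsets V 2"
      using sV V(2,3) by (auto simp: A_def B_def)
    have AB: "A \<inter> B = {}"
      using dis sV by (auto simp: A_def B_def doubleton_eq_iff)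
    have "inj_on (\<lambda>a. {s, a}) X" for X
      by (auto simp: inj_on_def doubleton_eq_iff)
    then have cards: "card A = card M" "card B = card K"
      by (auto simp: A_def B_def card_image)
    have split: "joined E M K (insert s C) = (if h E then insert s (joined E M K C) else joined E M K C)" for E
      by (auto simp: joined_def h_def A_def B_def)
    have finj: "finite (joined E M K C)" "s \<notin> joined E M K C" for E
      using insert by (auto simp: joined_def)
    have "expect (nsets V 2) p (\<lambda>E. z ^ card (joined E M K (insert s C))) =
        expect (nsets V 2) p (\<lambda>E. (if h E then z else 1) * z ^ card (joined E M K C))"
      by (intro expect_cong) (simp add: split finj)
    also have "\<dots> = expect (nsets V 2) p (\<lambda>E. if h E then z else 1) *
        expect (nsets V 2) p (\<lambda>E. z ^ card (joined E M K C))"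
    proof (rule expect_mult_indep[OF fin, where J = "A \<union> B"])
      fix E
      have "E \<inter> (A \<union> B) \<inter> A = E \<inter> A" "E \<inter> (A \<union> B) \<inter> B = E \<inter> B"
        by auto
      then show "(if h E then z else 1) = (if h (E \<inter> (A \<union> B)) then z else 1)"
        by (simp add: h_def)
      have "joined (E - (A \<union> B)) M K C = joined E M K C"
        using insert by (intro joined_minus) (auto simp: A_def B_def doubleton_eq_iff)
      then show "z ^ card (joined E M K C) = z ^ card (joined (E - (A \<union> B)) M K C)"
        by simp
    qed
    also have "expect (nsets V 2) p (\<lambda>E. if h E then z else 1) =
        expect (nsets V 2) p (\<lambda>E. 1 - of_bool (h E) * (1 - z))"
      by (intro expect_cong) auto
    also have "\<dots> = 1 - expect (nsets V 2) p (\<lambda>E. of_bool (h E)) * (1 - z)"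
      using fin by (subst Bochner_Integration.integral_diff) auto
    also have "expect (nsets V 2) p (\<lambda>E. of_bool (h E)) = \<rho>"
      unfolding h_def using prob_hit_avoid[OF fin sub AB p] by (simp add: cards \<rho>_def)
    finally show ?case
      using insert by (simp add: \<rho>_def)
  qed
qed

text \<open>
  Exponential Markov inequality with exponent \<open>\<theta>\<close>. The error must be relative to the mean degree,
  which may be far below the deviations of order \<open>sqrt n\<close> that a bound by the number of trials allows.
\<close>

lemma prob_high_degree_le:
  assumes V: "finite V" "x \<in> V" and p: "0 \<le> p" "p \<le> 1" and \<theta>: "0 \<le> \<theta>" "\<theta> \<le> 1"
  shows "expect (nsets V 2) p (\<lambda>E. of_bool ((1 + 2 * \<theta>) * (real (card V) * p) < real (card (neighbours E x))))
    \<le> exp (- (\<theta>\<^sup>2 * (real (card V) * p)))"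
proof -
  define d where "d = real (card V) * p"
  define c where "c = exp (- (\<theta> * ((1 + 2 * \<theta>) * d)))"
  have fin: "finite (nsets V 2)"
    using V(1) by (rule finite_imp_finite_nsets)
  have nb: "neighbours E x = joined E {x} {} (V - {x})" if "E \<subseteq> nsets V 2" for E
    using that by (auto simp: neighbours_def joined_def insert_commute nsets_def subset_iff)
  have "expect (nsets V 2) p (\<lambda>E. of_bool ((1 + 2 * \<theta>) * d < real (card (neighbours E x)))) \<le>
      expect (nsets V 2) p (\<lambda>E. c * exp \<theta> ^ card (joined E {x} {} (V - {x})))"
  proof (rule expect_bound_of_nonneg[OF fin])
    fix E assume E: "E \<subseteq> nsets V 2" and less: "(1 + 2 * \<theta>) * d < real (card (neighbours E x))"
    have "c * exp \<theta> ^ card (joined E {x} {} (V - {x})) =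
        exp (\<theta> * (real (card (neighbours E x)) - (1 + 2 * \<theta>) * d))"
      unfolding c_def nb[OF E, symmetric] by (simp add: mult_exp_exp algebra_simps flip: exp_of_nat_mult)
    also have "\<dots> \<ge> 1"
      using less \<theta> by simp
    finally show "1 \<le> c * exp \<theta> ^ card (joined E {x} {} (V - {x}))" .
  qed (simp add: c_def)
  also have "\<dots> = c * (1 - p * (1 - exp \<theta>)) ^ card (V - {x})"
    using expect_power_card_joined[of V "{x}" "{}" "V - {x}" p "exp \<theta>"] V p by simp
  also have "\<dots> \<le> c * exp (d * (\<theta> + \<theta>\<^sup>2))"
  proof (rule mult_left_mono)
    have "exp \<theta> - 1 \<le> \<theta> + \<theta>\<^sup>2"
      using exp_bound[of \<theta>] \<theta> by simp
    have "0 \<le> p * (exp \<theta> - 1)"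
      using p \<theta> by simp
    moreover have "1 - p * (1 - exp \<theta>) = 1 + p * (exp \<theta> - 1)"
      by (simp add: algebra_simps)
    ultimately have "(1 - p * (1 - exp \<theta>)) ^ card (V - {x}) \<le> exp (p * (exp \<theta> - 1)) ^ card (V - {x})"
      using exp_ge_add_one_self[of "p * (exp \<theta> - 1)"] by (intro power_mono) linarith+
    also have "\<dots> \<le> exp (p * (exp \<theta> - 1)) ^ card V"
      using p \<theta> V by (intro power_increasing) (auto intro: card_mono)
    also have "\<dots> = exp (d * (exp \<theta> - 1))"
      by (simp add: d_def algebra_simps flip: exp_of_nat_mult)
    also have "\<dots> \<le> exp (d * (\<theta> + \<theta>\<^sup>2))"
      using \<open>exp \<theta> - 1 \<le> \<theta> + \<theta>\<^sup>2\<close> p by (simp add: d_def mult_left_mono)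
    finally show "(1 - p * (1 - exp \<theta>)) ^ card (V - {x}) \<le> exp (d * (\<theta> + \<theta>\<^sup>2))" .
  qed (simp add: c_def)
  also have "\<dots> = exp (- (\<theta>\<^sup>2 * d))"
    unfolding c_def mult_exp_exp by (simp add: algebra_simps power2_eq_square)
  finally show ?thesis
    by (simp add: d_def)
qed

lemma prob_few_joined_le:
  assumes V: "finite V" "M \<subseteq> V" "C \<subseteq> V" "C \<inter> M = {}" and p: "0 \<le> p" "p \<le> 1"
    and \<theta>: "0 \<le> \<theta>" "\<theta> \<le> 1" and \<mu>: "\<mu> \<le> (1 - (1 - p) ^ card M) * real (card C)"
  shows "expect (nsets V 2) p (\<lambda>E. of_bool (real (card (joined E M {} C)) < (1 - 2 * \<theta>) * \<mu>))
    \<le> exp (- (\<theta>\<^sup>2 * \<mu>))"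
proof -
  define \<rho> where "\<rho> = 1 - (1 - p) ^ card M"
  define c where "c = exp (\<theta> * ((1 - 2 * \<theta>) * \<mu>))"
  have \<rho>: "0 \<le> \<rho>" "\<rho> \<le> 1"
    using hit_probability_bounds[OF p, of "card M" 0] by (auto simp: \<rho>_def)
  have fin: "finite (nsets V 2)"
    using V(1) by (rule finite_imp_finite_nsets)
  have "expect (nsets V 2) p (\<lambda>E. of_bool (real (card (joined E M {} C)) < (1 - 2 * \<theta>) * \<mu>)) \<le>
      expect (nsets V 2) p (\<lambda>E. c * exp (- \<theta>) ^ card (joined E M {} C))"
  proof (rule expect_bound_of_nonneg[OF fin])
    fix E assume less: "real (card (joined E M {} C)) < (1 - 2 * \<theta>) * \<mu>"
    have "c * exp (- \<theta>) ^ card (joined E M {} C) =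
        exp (\<theta> * ((1 - 2 * \<theta>) * \<mu> - real (card (joined E M {} C))))"
      unfolding c_def by (simp add: mult_exp_exp algebra_simps flip: exp_of_nat_mult)
    also have "\<dots> \<ge> 1"
      using less \<theta> by simp
    finally show "1 \<le> c * exp (- \<theta>) ^ card (joined E M {} C)" .
  qed (simp add: c_def)
  also have "\<dots> = c * (1 - \<rho> * (1 - exp (- \<theta>))) ^ card C"
    using expect_power_card_joined[of V M "{}" C p "exp (- \<theta>)"] V p by (simp add: \<rho>_def)
  also have "\<dots> \<le> c * exp (- (\<mu> * (\<theta> - \<theta>\<^sup>2)))"
  proof (rule mult_left_mono)
    have e: "\<theta> - \<theta>\<^sup>2 \<le> 1 - exp (- \<theta>)"
      using \<theta>(1) by (rule one_minus_exp_ge)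
    have "0 \<le> \<theta> - \<theta>\<^sup>2"
      using \<theta> mult_left_le[of \<theta> \<theta>] by (simp add: power2_eq_square)
    have "0 \<le> \<rho> * (1 - exp (- \<theta>))" "\<rho> * (1 - exp (- \<theta>)) \<le> 1"
      using \<rho> \<theta> by (auto intro!: mult_le_one)
    then have "(1 - \<rho> * (1 - exp (- \<theta>))) ^ card C \<le> exp (- (real (card C) * (\<rho> * (1 - exp (- \<theta>)))))"
      by (rule one_minus_power_le_exp)
    also have "\<dots> \<le> exp (- (\<mu> * (\<theta> - \<theta>\<^sup>2)))"
    proof -
      have "\<mu> * (\<theta> - \<theta>\<^sup>2) \<le> (\<rho> * real (card C)) * (\<theta> - \<theta>\<^sup>2)"
        using \<mu> \<open>0 \<le> \<theta> - \<theta>\<^sup>2\<close> by (intro mult_right_mono) (simp_all add: \<rho>_def)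
      also have "\<dots> \<le> (\<rho> * real (card C)) * (1 - exp (- \<theta>))"
        using e \<rho> by (intro mult_left_mono) auto
      finally show ?thesis
        by (simp add: algebra_simps)
    qed
    finally show "(1 - \<rho> * (1 - exp (- \<theta>))) ^ card C \<le> exp (- (\<mu> * (\<theta> - \<theta>\<^sup>2)))" .
  qed (simp add: c_def)
  also have "\<dots> = exp (- (\<theta>\<^sup>2 * \<mu>))"
    unfolding c_def mult_exp_exp by (simp add: algebra_simps power2_eq_square)
  finally show ?thesis .
qed

lemma sum_power_card_Pow:
  fixes x :: real
  assumes "finite R"
  shows "(\<Sum>A\<in>Pow R. x ^ card A) = (1 + x) ^ card R"
  using prod_add[OF assms, of "\<lambda>_. x" "\<lambda>_. 1"] by (simp add: add.commute)

text \<open>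
  Union bound over all small sets \<open>A\<close>. A set of size \<open>a\<close> fails to expand with probability at most
  \<open>x ^ a\<close> where \<open>x = exp (- (\<theta>\<^sup>2 * \<mu>))\<close>, and over all nonempty sets these bounds sum to at most \<open>(1 + x) ^ n - 1\<close>.
\<close>

lemma prob_not_expands_le:
  assumes V: "finite V" "R \<subseteq> V" and p: "0 \<le> p" "p \<le> 1" and \<theta>: "0 \<le> \<theta>" "\<theta> \<le> 1"
    and \<mu>: "\<And>a. 1 \<le> a \<Longrightarrow> real a \<le> a0 \<Longrightarrow> \<mu> * real a \<le> (1 - (1 - p) ^ a) * (real (card R) - 1 - real a)"
    and small: "real (card V) * exp (- (\<theta>\<^sup>2 * \<mu>)) \<le> 1"
  shows "expect (nsets V 2) p (\<lambda>E. of_bool (\<not> expands E R u ((1 - 2 * \<theta>) * \<mu>) a0))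
    \<le> 2 * real (card V) * exp (- (\<theta>\<^sup>2 * \<mu>))"
proof -
  define x where "x = exp (- (\<theta>\<^sup>2 * \<mu>))"
  define \<A> where "\<A> = {A. A \<subseteq> R \<and> A \<noteq> {} \<and> real (card A) \<le> a0}"
  define few where "few A E \<longleftrightarrow> real (card (joined E A {} (R - {u} - A))) < (1 - 2 * \<theta>) * (\<mu> * real (card A))" for A E
  have fin: "finite (nsets V 2)"
    using V(1) by (rule finite_imp_finite_nsets)
  have finR: "finite R"
    using V finite_subset by auto
  have fA: "\<A> \<subseteq> Pow R - {{}}" "finite \<A>"
    using finR by (auto simp: \<A>_def)
  have "expect (nsets V 2) p (\<lambda>E. of_bool (\<not> expands E R u ((1 - 2 * \<theta>) * \<mu>) a0)) \<le>
      expect (nsets V 2) p (\<lambda>E. \<Sum>A\<in>\<A>. of_bool (few A E))"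
  proof (rule expect_bound_of_nonneg[OF fin])
    fix E assume "\<not> expands E R u ((1 - 2 * \<theta>) * \<mu>) a0"
    then obtain A where "A \<in> \<A>" "few A E"
      by (auto simp: expands_def \<A>_def few_def not_le mult.assoc)
    then show "1 \<le> (\<Sum>A\<in>\<A>. of_bool (few A E) :: real)"
      using fA member_le_sum[of A \<A> "\<lambda>A. of_bool (few A E) :: real"] by auto
  qed (simp add: sum_nonneg)
  also have "\<dots> = (\<Sum>A\<in>\<A>. expect (nsets V 2) p (\<lambda>E. of_bool (few A E)))"
    by (rule expect_sum[OF fin])
  also have "\<dots> \<le> (\<Sum>A\<in>\<A>. x ^ card A)"
  proof (rule sum_mono)
    fix A assume A: "A \<in> \<A>"
    then have AR: "A \<subseteq> R" "A \<noteq> {}" "real (card A) \<le> a0" "finite A"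
      using finR finite_subset by (auto simp: \<A>_def)
    have "card R \<le> card (R - {u} - A) + card (insert u A)"
      using finR AR by (intro order_trans[OF card_mono card_Un_le]) auto
    also have "card (insert u A) \<le> 1 + card A"
      using AR by (simp add: card_insert_if)
    finally have cR: "real (card R) - 1 - real (card A) \<le> real (card (R - {u} - A))"
      by simp
    have "\<mu> * real (card A) \<le> (1 - (1 - p) ^ card A) * (real (card R) - 1 - real (card A))"
      using AR by (intro \<mu>) (auto simp: Suc_le_eq card_gt_0_iff)
    also have "\<dots> \<le> (1 - (1 - p) ^ card A) * real (card (R - {u} - A))"
      using cR hit_probability_bounds[OF p, of "card A" 0] by (intro mult_left_mono) auto
    finally have "expect (nsets V 2) p (\<lambda>E. of_bool (few A E)) \<le> exp (- (\<theta>\<^sup>2 * (\<mu> * real (card A))))"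
      unfolding few_def using V AR p \<theta> by (intro prob_few_joined_le) auto
    also have "\<dots> = x ^ card A"
      by (simp add: x_def algebra_simps flip: exp_of_nat_mult)
    finally show "expect (nsets V 2) p (\<lambda>E. of_bool (few A E)) \<le> x ^ card A" .
  qed
  also have "\<dots> \<le> (\<Sum>A\<in>Pow R - {{}}. x ^ card A)"
    using fA finR by (intro sum_mono2) (auto simp: x_def)
  also have "\<dots> = (1 + x) ^ card R - 1"
    using finR by (simp add: sum_diff1 sum_power_card_Pow)
  also have "(1 + x) ^ card R \<le> (1 + x) ^ card V"
    using V by (intro power_increasing card_mono) (auto simp: x_def)
  also have "\<dots> \<le> exp x ^ card V"
    by (intro power_mono) (auto simp: x_def)
  also have "\<dots> = exp (real (card V) * x)"
    by (simp flip: exp_of_nat_mult)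
  also have "\<dots> \<le> 1 + real (card V) * x + (real (card V) * x)\<^sup>2"
    using small by (intro exp_bound) (auto simp: x_def)
  also have "(real (card V) * x)\<^sup>2 \<le> real (card V) * x"
    using small mult_left_le[of "real (card V) * x" "real (card V) * x"] by (simp add: x_def power2_eq_square)
  finally show ?thesis
    by (simp add: x_def)
qed

text \<open>
  Expose the ball \<open>B\<close> around \<open>v\<close> in the graph without the vertex \<open>u\<close>. All pairs outside \<open>B\<close>,
  including those at \<open>u\<close>, remain fresh, so that expansion outside \<open>B\<close> fails with small probability for every
  outcome of \<open>B\<close>.
\<close>

lemma prob_small_goal_set_le:
  assumes V: "finite V" and uv: "u \<in> V" "v \<in> V" "u \<noteq> v" and p: "0 \<le> p" "p \<le> 1" and \<theta>: "0 \<le> \<theta>" "\<theta> \<le> 1"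
    and \<Delta>: "2 \<le> \<Delta>"
    and \<mu>: "\<And>a. 1 \<le> a \<Longrightarrow> real a \<le> \<Delta> ^ j \<Longrightarrow>
      \<mu> * real a \<le> (1 - (1 - p) ^ a) * (real (card V) - 2 * \<Delta> ^ Suc j - 1 - real a)"
    and small: "real (card V) * exp (- (\<theta>\<^sup>2 * \<mu>)) \<le> 1"
    and g: "0 < g" "0 \<le> (1 - 2 * \<theta>) * \<mu>"
    and step: "\<And>i. i < j \<Longrightarrow> 2 * \<Delta> ^ i \<le> ((1 - 2 * \<theta>) * \<mu> - g) * g ^ i"
  shows "expect (nsets V 2) p (\<lambda>E. of_bool ((\<forall>y\<in>V. real (card (neighbours E y)) \<le> \<Delta>) \<and>
      real (card (goal_set (exploration E u v j))) < g ^ j))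
    \<le> 2 * real (card V) * exp (- (\<theta>\<^sup>2 * \<mu>))"
proof -
  define \<nu> where "\<nu> = (1 - 2 * \<theta>) * \<mu>"
  define ball where "ball E = reached {e \<in> E. u \<notin> e} v (Suc (Suc j))" for E
  define \<C> where "\<C> = {c. c \<subseteq> V \<and> real (card c) \<le> 2 * \<Delta> ^ Suc j}"
  have fin: "finite (nsets V 2)"
    using V by (rule finite_imp_finite_nsets)
  have "expect (nsets V 2) p (\<lambda>E. of_bool ((\<forall>y\<in>V. real (card (neighbours E y)) \<le> \<Delta>) \<and>
      real (card (goal_set (exploration E u v j))) < g ^ j)) \<le>
    expect (nsets V 2) p (\<lambda>E. if ball E \<in> \<C> then of_bool (\<not> expands E (V - ball E) u \<nu> (\<Delta> ^ j)) else 0)"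
  proof (rule expect_bound_of_nonneg[OF fin])
    fix E assume E: "E \<subseteq> nsets V 2" and bad: "(\<forall>y\<in>V. real (card (neighbours E y)) \<le> \<Delta>) \<and>
      real (card (goal_set (exploration E u v j))) < g ^ j"
    then have "\<not> expands E (V - ball E) u \<nu> (\<Delta> ^ j)"
      using card_goal_set_ge[OF E V uv _ \<Delta> _ g(1) step g(2)] unfolding ball_def \<nu>_def by force
    moreover have "ball E \<in> \<C>"
    proof -
      let ?F = "{e \<in> E. u \<notin> e}"
      have F: "?F \<subseteq> nsets V 2"
        using E by auto
      have "real (card (neighbours ?F y)) \<le> \<Delta>" if "y \<in> V" for y
      proof -
        have "finite (neighbours E y)"
          using E V by (intro finite_subset[of "neighbours E y" V]) (auto simp: neighbours_def nsets_def)
        then have "card (neighbours ?F y) \<le> card (neighbours E y)"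
          by (intro card_mono) (auto simp: neighbours_def)
        then show ?thesis
          using bad that by fastforce
      qed
      then show ?thesis
        using card_reached_le[OF F V uv(2) _ \<Delta>, of "Suc j"] reached_subset[OF F uv(2)]
        unfolding \<C>_def ball_def by blast
    qed
    ultimately show "1 \<le> (if ball E \<in> \<C> then of_bool (\<not> expands E (V - ball E) u \<nu> (\<Delta> ^ j)) else (0::real))"
      by simp
  qed auto
  also have "\<dots> \<le> 2 * real (card V) * exp (- (\<theta>\<^sup>2 * \<mu>))"
  proof (rule expect_exposed_le[OF fin, where J = "\<lambda>c. {e. e \<inter> c \<noteq> {}}"])
    fix X Y :: "nat set set"
    assume "Y \<inter> {e. e \<inter> ball X \<noteq> {}} = X \<inter> {e. e \<inter> ball X \<noteq> {}}"
    then have "e \<in> Y \<longleftrightarrow> e \<in> X" if "e \<inter> ball X \<noteq> {}" for e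
      using that by blast
    then show "ball Y = ball X"
      unfolding ball_def by (intro reached_exposed[where i = "Suc (Suc j)"]) auto
  next
    fix c and X :: "nat set set"
    have "joined (X - {e. e \<inter> c \<noteq> {}}) A {} (V - c - {u} - A) = joined X A {} (V - c - {u} - A)"
      if "A \<subseteq> V - c" for A
      using that by (intro joined_minus) auto
    then show "(of_bool (\<not> expands X (V - c) u \<nu> (\<Delta> ^ j)) :: real) =
        of_bool (\<not> expands (X - {e. e \<inter> c \<noteq> {}}) (V - c) u \<nu> (\<Delta> ^ j))"
      by (simp add: expands_def)
  next
    fix c assume c: "c \<in> \<C>"
    then have "c \<subseteq> V" "finite c"
      using V finite_subset by (auto simp: \<C>_def)
    then have "real (card V) - 2 * \<Delta> ^ Suc j \<le> real (card (V - c))"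
      using c V card_mono[of V c] by (simp add: \<C>_def card_Diff_subset of_nat_diff)
    then have "(1 - (1 - p) ^ a) * (real (card V) - 2 * \<Delta> ^ Suc j - 1 - real a) \<le>
        (1 - (1 - p) ^ a) * (real (card (V - c)) - 1 - real a)" for a
      using hit_probability_bounds[OF p, of a 0] by (intro mult_left_mono) auto
    then show "expect (nsets V 2) p (\<lambda>X. of_bool (\<not> expands X (V - c) u \<nu> (\<Delta> ^ j)))
        \<le> 2 * real (card V) * exp (- (\<theta>\<^sup>2 * \<mu>))"
      unfolding \<nu>_def using \<mu> by (intro prob_not_expands_le V p \<theta> small) (auto intro: order_trans)
  qed simp
  finally show ?thesis .
qed

text \<open>
  The quantity \<open>(1 - r) ^ w\<close> is the probability that a random vertex set of density \<open>r\<close> avoids all \<open>w\<close>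
  witnesses. Given the outcome of the exploration, each fresh vertex is a witness in this random
  set independently with the same probability, and \<open>\<tau>\<close> is a lower bound for the expected number.
\<close>

lemma expect_power_card_witnesses_le:
  assumes V: "finite V" and uv: "u \<in> V" "v \<in> V" and p: "0 \<le> p" "p \<le> 1" and r: "0 \<le> r" "r \<le> 1"
    and \<tau>: "\<And>a b c. a0 \<le> real a \<Longrightarrow> real b \<le> b0 \<Longrightarrow> c0 \<le> real c \<Longrightarrow>
      \<tau> \<le> real c * ((1 - (1 - p) ^ a) * (1 - p) ^ b * r)"
  shows "expect (nsets V 2) p (\<lambda>E. if a0 \<le> real (card (goal_set (exploration E u v j))) \<and>
      real (card (block_set (exploration E u v j))) \<le> b0 \<and>
      c0 \<le> real (card (fresh_set V (exploration E u v j)))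
    then (1 - r) ^ card (witnesses V (exploration E u v j) E) else 0) \<le> exp (- \<tau>)"
proof -
  define \<C> where "\<C> = {c. goal_set c \<subseteq> V \<and> block_set c \<subseteq> V \<and> a0 \<le> real (card (goal_set c)) \<and>
      real (card (block_set c)) \<le> b0 \<and> c0 \<le> real (card (fresh_set V c))}"
  have fin: "finite (nsets V 2)"
    using V by (rule finite_imp_finite_nsets)
  have "expect (nsets V 2) p (\<lambda>E. if a0 \<le> real (card (goal_set (exploration E u v j))) \<and>
      real (card (block_set (exploration E u v j))) \<le> b0 \<and>
      c0 \<le> real (card (fresh_set V (exploration E u v j)))
    then (1 - r) ^ card (witnesses V (exploration E u v j) E) else 0) =
    expect (nsets V 2) p (\<lambda>E. if exploration E u v j \<in> \<C>
      then (1 - r) ^ card (witnesses V (exploration E u v j) E) else 0)"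
  proof (rule expect_cong)
    fix E assume E: "E \<subseteq> nsets V 2"
    then have "E - {{u, v}} \<subseteq> nsets V 2"
      by auto
    then have "goal_set (exploration E u v j) \<subseteq> V" "block_set (exploration E u v j) \<subseteq> V"
      using reached_subset[of "E - {{u, v}}" V u] reached_subset[of "E - {{u, v}}" V v] uv
      unfolding goal_set_def block_set_def exploration_def Let_def split_conv by blast+
    then show "(if a0 \<le> real (card (goal_set (exploration E u v j))) \<and>
      real (card (block_set (exploration E u v j))) \<le> b0 \<and>
      c0 \<le> real (card (fresh_set V (exploration E u v j)))
    then (1 - r) ^ card (witnesses V (exploration E u v j) E) else 0) =
      (if exploration E u v j \<in> \<C> then (1 - r) ^ card (witnesses V (exploration E u v j) E) else 0)"
      by (simp add: \<C>_def)
  qed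
  also have "\<dots> \<le> exp (- \<tau>)"
  proof (rule expect_exposed_le[OF fin, where J = explored_edges and f = "\<lambda>c E. (1 - r) ^ card (witnesses V c E)"])
    fix c assume c: "c \<in> \<C>"
    define \<rho> where "\<rho> = (1 - (1 - p) ^ card (goal_set c)) * (1 - p) ^ card (block_set c)"
    have \<rho>: "0 \<le> \<rho>" "\<rho> \<le> 1"
      using hit_probability_bounds[OF p] by (auto simp: \<rho>_def)
    have "expect (nsets V 2) p (\<lambda>E. (1 - r) ^ card (witnesses V c E)) = (1 - \<rho> * (1 - (1 - r))) ^ card (fresh_set V c)"
      unfolding witnesses_def \<rho>_def using c V p
      by (intro expect_power_card_joined)
        (auto simp: \<C>_def goal_set_def block_set_def fresh_set_def)
    also have "\<dots> \<le> exp (- (real (card (fresh_set V c)) * (\<rho> * (1 - (1 - r)))))"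
      using \<rho> r by (intro one_minus_power_le_exp) (auto intro: mult_le_one)
    also have "\<dots> \<le> exp (- \<tau>)"
      using \<tau>[of "card (goal_set c)" "card (block_set c)" "card (fresh_set V c)"] c
      by (simp add: \<C>_def \<rho>_def)
    finally show "expect (nsets V 2) p (\<lambda>E. (1 - r) ^ card (witnesses V c E)) \<le> exp (- \<tau>)" .
  qed (auto simp: witnesses_unexplored intro: exploration_exposed)
  finally show ?thesis .
qed

lemma expect_eq_sum:
  fixes f :: "'a set \<Rightarrow> real"
  assumes "finite I"
  shows "expect I p f = (\<Sum>X\<in>Pow I. f X * pmf (random_subset I p) X)"
  using assms set_random_subset[of I p] by (intro integral_measure_pmf_real) auto

lemma expect_swap:
  fixes f :: "'a set \<Rightarrow> 'b set \<Rightarrow> real"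
  assumes "finite I" "finite I'"
  shows "expect I p (\<lambda>X. expect I' q (\<lambda>Y. f X Y)) = expect I' q (\<lambda>Y. expect I p (\<lambda>X. f X Y))"
proof -
  have "(\<Sum>X\<in>Pow I. \<Sum>Y\<in>Pow I'. f X Y * pmf (random_subset I' q) Y * pmf (random_subset I p) X) =
    (\<Sum>Y\<in>Pow I'. \<Sum>X\<in>Pow I. f X Y * pmf (random_subset I' q) Y * pmf (random_subset I p) X)"
    by (rule sum.swap)
  then show ?thesis
    using assms by (simp add: expect_eq_sum sum_distrib_left sum_distrib_right mult.assoc mult.commute mult.left_commute)
qed

lemma expect_less_imp_exists:
  fixes f :: "'a set \<Rightarrow> real"
  assumes "finite I" "expect I p f < b"
  shows "\<exists>X\<subseteq>I. f X < b"
proof (rule ccontr)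
  assume "\<not> (\<exists>X\<subseteq>I. f X < b)"
  then have "expect I p (\<lambda>_. b) \<le> expect I p f"
    using assms by (intro expect_mono) (auto simp: not_less)
  then show False
    using assms by simp
qed

section \<open>Averaging over the random vertex set\<close>

text \<open>
  Averaging over a random vertex set \<open>S\<close> of density \<open>r\<close>. The event that some pair has no witness in
  \<open>S\<close> is dominated by three sums: vertices of high degree, pairs for which the goal set is small
  although the degrees are bounded, and pairs with a typical exploration without witness in \<open>S\<close>.
\<close>

lemma exists_reconstructing_set:
  fixes n j :: nat and p r \<theta>' \<theta> \<Delta> \<mu> g \<tau> m \<eta> :: real
  assumes p: "0 \<le> p" "p \<le> 1" and r: "0 \<le> r" "r \<le> 1"
    and \<theta>': "0 \<le> \<theta>'" "\<theta>' \<le> 1" and \<theta>: "0 \<le> \<theta>" "\<theta> \<le> 1"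
    and \<Delta>_eq: "\<Delta> = (1 + 2 * \<theta>') * (real n * p)" and \<Delta>: "2 \<le> \<Delta>"
    and \<mu>: "\<And>a. 1 \<le> a \<Longrightarrow> real a \<le> \<Delta> ^ j \<Longrightarrow>
      \<mu> * real a \<le> (1 - (1 - p) ^ a) * (real n - 2 * \<Delta> ^ Suc j - 1 - real a)"
    and small: "real n * exp (- (\<theta>\<^sup>2 * \<mu>)) \<le> 1"
    and g: "0 < g" "0 \<le> (1 - 2 * \<theta>) * \<mu>"
    and step: "\<And>i. i < j \<Longrightarrow> 2 * \<Delta> ^ i \<le> ((1 - 2 * \<theta>) * \<mu> - g) * g ^ i"
    and \<tau>: "\<And>a b c. g ^ j \<le> real a \<Longrightarrow> real b \<le> \<Delta> ^ Suc j \<Longrightarrow> real n - 4 * \<Delta> ^ Suc j \<le> real c \<Longrightarrow>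
      \<tau> \<le> real c * ((1 - (1 - p) ^ a) * (1 - p) ^ b * r)"
    and \<eta>: "real n * exp (- (\<theta>'\<^sup>2 * (real n * p))) + (real n)\<^sup>2 * (2 * real n * exp (- (\<theta>\<^sup>2 * \<mu>))) +
      (real n)\<^sup>2 * exp (- \<tau>) \<le> \<eta>" "0 < \<eta>"
    and m: "0 < m" "real n * r \<le> 14 / 15 * m"
  shows "\<exists>S\<subseteq>{1..n}. real (card S) \<le> m \<and>
    measure_pmf.prob (binomial_random_graph n p) {G. \<not> reconstructible n (pairs_meeting n S) G} \<le> 16 * \<eta>"
proof -
  define V where "V = {1..n}"
  define P where "P = nsets V 2"
  define D where "D = {(u, v) \<in> V \<times> V. u \<noteq> v}"
  define wit where "wit = (\<lambda>(u, v) E. witnesses V (exploration E u v j) E)"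
  define regular where "regular E \<longleftrightarrow> (\<forall>y\<in>V. real (card (neighbours E y)) \<le> \<Delta>)" for E
  define sparse where "sparse = (\<lambda>(u, v) E. regular E \<and> real (card (goal_set (exploration E u v j))) < g ^ j)"
  define typical where "typical = (\<lambda>(u, v) E. g ^ j \<le> real (card (goal_set (exploration E u v j))) \<and>
      real (card (block_set (exploration E u v j))) \<le> \<Delta> ^ Suc j \<and>
      real n - 4 * \<Delta> ^ Suc j \<le> real (card (fresh_set V (exploration E u v j))))"
  define bad where "bad S E \<longleftrightarrow> (\<exists>d\<in>D. S \<inter> wit d E = {})" for S E
  have finV: "finite V" "card V = n" and fin: "finite P"
    by (simp_all add: V_def P_def finite_imp_finite_nsets)
  have D: "D \<subseteq> V \<times> V"
    by (auto simp: D_def)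
  then have finD: "finite D"
    using finV by (meson finite_SigmaI finite_subset)
  have "card D \<le> card (V \<times> V)"
    using D finV by (intro card_mono) auto
  then have "real (card D) \<le> real (n * n)"
    using finV by (simp only: card_cartesian_product of_nat_le_iff)
  then have cD: "real (card D) \<le> (real n)\<^sup>2"
    by (simp add: power2_eq_square)
  have dom: "of_bool (bad S E) \<le> (\<Sum>x\<in>V. of_bool (\<Delta> < real (card (neighbours E x)))) +
      (\<Sum>d\<in>D. of_bool (sparse d E)) + (\<Sum>d\<in>D. if typical d E then of_bool (S \<inter> wit d E = {}) else (0::real))"
    (is "_ \<le> ?s1 + ?s2 + ?s3") if E: "E \<subseteq> P" for S E
  proof (cases "bad S E")
    case False
    then show ?thesis
      by (simp add: sum_nonneg add_nonneg_nonneg)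
  next
    case True
    then obtain u v where uv: "(u, v) \<in> D" "S \<inter> wit (u, v) E = {}"
      by (auto simp: bad_def)
    then have V_uv: "u \<in> V" "v \<in> V"
      using D by auto
    have nonneg: "0 \<le> ?s1" "0 \<le> ?s2" "0 \<le> ?s3"
      by (simp_all add: sum_nonneg)
    consider "\<not> regular E" | "sparse (u, v) E" | "typical (u, v) E"
    proof (cases "regular E \<and> \<not> sparse (u, v) E")
      case True
      define H where "H = E - {{u, v}}"
      have H: "H \<subseteq> nsets V 2"
        using E by (auto simp: H_def P_def)
      have deg: "real (card (neighbours H y)) \<le> \<Delta>" if "y \<in> V" for y
      proof -
        have "finite (neighbours E y)"
          using E finV by (intro finite_subset[of "neighbours E y" V]) (auto simp: neighbours_def nsets_def P_def)
        then have "card (neighbours H y) \<le> card (neighbours E y)"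
          by (intro card_mono) (auto simp: neighbours_def H_def)
        then show ?thesis
          using True that by (fastforce simp: regular_def)
      qed
      have fr: "finite (reached H x i)" if "x \<in> V" for x i
        using reached_subset[OF H that] finV finite_subset by blast
      have "card (block_set (exploration E u v j)) \<le> card (reached H v (Suc (Suc j)) - reached H v (Suc j))"
        using fr[OF V_uv(2)] by (intro card_mono) (auto simp: block_set_def exploration_def Let_def H_def)
      then have block: "real (card (block_set (exploration E u v j))) \<le> \<Delta> ^ Suc j"
        using card_layer_le[OF H finV(1) V_uv(2) deg, of "Suc j"] by simp
      have "card V \<le> card (fresh_set V (exploration E u v j)) + card (reached H u (Suc j) \<union> reached H v (Suc (Suc j)))"
        using reached_mono[of j "Suc j" H u] reached_mono[of "Suc j" "Suc (Suc j)" H v] finV fr V_uv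
        by (intro order_trans[OF card_mono card_Un_le])
          (auto simp: fresh_set_def exploration_def Let_def H_def[symmetric])
      also have "\<dots> \<le> card (fresh_set V (exploration E u v j)) + (card (reached H u (Suc j)) + card (reached H v (Suc (Suc j))))"
        by (intro add_left_mono card_Un_le)
      finally have "real n \<le> real (card (fresh_set V (exploration E u v j))) + (2 * \<Delta> ^ j + 2 * \<Delta> ^ Suc j)"
        using card_reached_le[OF H finV(1) V_uv(1) deg \<Delta>, of j] card_reached_le[OF H finV(1) V_uv(2) deg \<Delta>, of "Suc j"] finV
        by linarith
      moreover have "\<Delta> ^ j \<le> \<Delta> ^ Suc j"
        using \<Delta> by (intro power_increasing) auto
      ultimately have "typical (u, v) E"
        using block True by (auto simp: typical_def sparse_def)
      then show ?thesis
        using that by blast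
    qed (use that in blast)
    then show ?thesis
    proof cases
      case 1
      then obtain y where y: "y \<in> V" "\<Delta> < real (card (neighbours E y))"
        by (auto simp: regular_def not_le)
      then have "1 \<le> ?s1"
        using member_le_sum[of y V "\<lambda>x. of_bool (\<Delta> < real (card (neighbours E x))) :: real"] finV by auto
      then show ?thesis
        using nonneg True by simp
    next
      case 2
      then have "1 \<le> ?s2"
        using member_le_sum[of "(u, v)" D "\<lambda>d. of_bool (sparse d E) :: real"] finD uv by auto
      then show ?thesis
        using nonneg True by simp
    next
      case 3
      then have "1 \<le> ?s3"
        using member_le_sum[of "(u, v)" D "\<lambda>d. if typical d E then of_bool (S \<inter> wit d E = {}) else (0::real)"] finD uv by auto
      then show ?thesis
        using nonneg True by simp
    qed
  qed
  define F where "F S = expect P p (\<lambda>E. of_bool (bad S E))" for S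
  have F0: "0 \<le> F S" for S
    unfolding F_def by (rule Bochner_Integration.integral_nonneg) simp
  have "expect V r F \<le> expect V r (\<lambda>S. expect P p (\<lambda>E. (\<Sum>x\<in>V. of_bool (\<Delta> < real (card (neighbours E x)))) +
      (\<Sum>d\<in>D. of_bool (sparse d E)) + (\<Sum>d\<in>D. if typical d E then of_bool (S \<inter> wit d E = {}) else (0::real))))"
    unfolding F_def by (intro expect_mono finV fin dom)
  also have "\<dots> = expect P p (\<lambda>E. expect V r (\<lambda>S. (\<Sum>x\<in>V. of_bool (\<Delta> < real (card (neighbours E x)))) +
      (\<Sum>d\<in>D. of_bool (sparse d E)) + (\<Sum>d\<in>D. if typical d E then of_bool (S \<inter> wit d E = {}) else (0::real))))"
    by (rule expect_swap[OF finV(1) fin])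
  also have "\<dots> = expect P p (\<lambda>E. (\<Sum>x\<in>V. of_bool (\<Delta> < real (card (neighbours E x)))) +
      (\<Sum>d\<in>D. of_bool (sparse d E)) + (\<Sum>d\<in>D. if typical d E then (1 - r) ^ card (wit d E) else (0::real)))"
  proof (rule expect_cong)
    fix E
    have "expect V r (\<lambda>S. if typical d E then of_bool (S \<inter> wit d E = {}) else (0::real)) =
        (if typical d E then (1 - r) ^ card (wit d E) else 0)" for d
    proof -
      have "wit d E \<subseteq> V"
        by (auto simp: wit_def dest: witness_certifies(1) split: prod.splits)
      then show ?thesis
        using prob_avoid[OF finV(1) _ r] by simp
    qed
    then show "expect V r (\<lambda>S. (\<Sum>x\<in>V. of_bool (\<Delta> < real (card (neighbours E x)))) +
        (\<Sum>d\<in>D. of_bool (sparse d E)) + (\<Sum>d\<in>D. if typical d E then of_bool (S \<inter> wit d E = {}) else (0::real))) =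
      (\<Sum>x\<in>V. of_bool (\<Delta> < real (card (neighbours E x)))) +
        (\<Sum>d\<in>D. of_bool (sparse d E)) + (\<Sum>d\<in>D. if typical d E then (1 - r) ^ card (wit d E) else (0::real))"
      using finV by (subst Bochner_Integration.integral_add) (simp_all add: expect_sum)
  qed
  also have "\<dots> = (\<Sum>x\<in>V. expect P p (\<lambda>E. of_bool (\<Delta> < real (card (neighbours E x))))) +
      (\<Sum>d\<in>D. expect P p (\<lambda>E. of_bool (sparse d E))) +
      (\<Sum>d\<in>D. expect P p (\<lambda>E. if typical d E then (1 - r) ^ card (wit d E) else 0))"
    using fin by (subst Bochner_Integration.integral_add, simp, simp,
        subst Bochner_Integration.integral_add, simp, simp) (simp only: expect_sum)
  also have "\<dots> \<le> (\<Sum>x\<in>V. exp (- (\<theta>'\<^sup>2 * (real n * p)))) + (\<Sum>d\<in>D. 2 * real n * exp (- (\<theta>\<^sup>2 * \<mu>))) + (\<Sum>d\<in>D. exp (- \<tau>))"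
  proof (intro add_mono sum_mono)
    fix x assume "x \<in> V"
    then show "expect P p (\<lambda>E. of_bool (\<Delta> < real (card (neighbours E x)))) \<le> exp (- (\<theta>'\<^sup>2 * (real n * p)))"
      using prob_high_degree_le[OF finV(1) _ p \<theta>', of x] by (simp add: P_def \<Delta>_eq finV)
  next
    fix d assume "d \<in> D"
    then obtain u v where uv: "d = (u, v)" "u \<in> V" "v \<in> V" "u \<noteq> v"
      by (auto simp: D_def)
    show "expect P p (\<lambda>E. of_bool (sparse d E)) \<le> 2 * real n * exp (- (\<theta>\<^sup>2 * \<mu>))"
      using prob_small_goal_set_le[OF finV(1) uv(2-4) p \<theta> \<Delta>, where \<mu> = \<mu> and g = g and j = j] \<mu> small g step
      by (simp add: P_def sparse_def regular_def uv(1) finV)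
    show "expect P p (\<lambda>E. if typical d E then (1 - r) ^ card (wit d E) else 0) \<le> exp (- \<tau>)"
      unfolding P_def typical_def wit_def uv(1) split_conv
      by (rule expect_power_card_witnesses_le[OF finV(1) uv(2,3) p r]) (rule \<tau>)
  qed
  also have "\<dots> = real n * exp (- (\<theta>'\<^sup>2 * (real n * p))) + real (card D) * (2 * real n * exp (- (\<theta>\<^sup>2 * \<mu>))) +
      real (card D) * exp (- \<tau>)"
    by (simp add: finV)
  also have "\<dots> \<le> \<eta>"
  proof -
    have le: "real (card D) * x \<le> (real n)\<^sup>2 * x" if "0 \<le> x" for x
      using cD that by (rule mult_right_mono)
    have "real (card D) * (2 * real n * exp (- (\<theta>\<^sup>2 * \<mu>))) \<le> (real n)\<^sup>2 * (2 * real n * exp (- (\<theta>\<^sup>2 * \<mu>)))"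
      by (rule le) simp
    moreover have "real (card D) * exp (- \<tau>) \<le> (real n)\<^sup>2 * exp (- \<tau>)"
      by (rule le) simp
    ultimately show ?thesis
      using \<eta>(1) by linarith
  qed
  finally have F: "expect V r F \<le> \<eta>" .
  \<comment> \<open>one set must satisfy both bounds, since the two normalised means add up to less than 1\<close>
  have "expect V r (\<lambda>S. real (card S) / m + F S / (16 * \<eta>)) =
      real n * r / m + expect V r F / (16 * \<eta>)"
    using expect_card[OF finV(1) r] finV by (subst Bochner_Integration.integral_add) simp_all
  also have "\<dots> \<le> 14 / 15 + 1 / 16"
    using F m \<eta>(2) by (intro add_mono) (auto simp: field_simps)
  also have "\<dots> < 1"
    by simp
  finally obtain S where S: "S \<subseteq> V" "real (card S) / m + F S / (16 * \<eta>) < 1"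
    using expect_less_imp_exists[OF finV(1)] by blast
  have "0 \<le> real (card S) / m" "0 \<le> F S / (16 * \<eta>)"
    using F0[of S] m \<eta> by auto
  then have "real (card S) / m \<le> 1" "F S / (16 * \<eta>) \<le> 1"
    using S(2) by linarith+
  then have "real (card S) \<le> m" "F S \<le> 16 * \<eta>"
    using m \<eta> by (simp_all add: field_simps)
  moreover have "measure_pmf.prob (binomial_random_graph n p) {G. \<not> reconstructible n (pairs_meeting n S) G} \<le> F S"
    unfolding binomial_random_graph_eq prob_eq_expect F_def P_def V_def
  proof (rule expect_mono)
    fix E assume E: "E \<subseteq> nsets {1..n} 2"
    have "reconstructible n (pairs_meeting n S) E" if nb: "\<not> bad S E"
    proof (rule reconstructible_if_certified[OF E, where k = "Suc j"])
      fix u v assume uv: "u \<in> {1..n}" "v \<in> {1..n}" "u \<noteq> v"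
      then obtain s where s: "s \<in> S" "s \<in> wit (u, v) E"
        using nb unfolding bad_def D_def V_def by blast
      then have "s \<in> witnesses V (exploration E u v j) E"
        by (simp add: wit_def)
      note witness_certifies[OF this]
      then show "\<exists>s\<in>S \<inter> {1..n}. s \<noteq> u \<and> s \<in> reached (E - {{u, v}}) u (Suc (Suc j)) \<and>
          s \<notin> reached (E - {{u, v}}) v (Suc (Suc (Suc j)))"
        using s(1) unfolding V_def by blast
    qed
    then show "of_bool (\<not> reconstructible n (pairs_meeting n S) E) \<le> (of_bool (bad S E) :: real)"
      by auto
  qed (simp add: finite_imp_finite_nsets)
  ultimately show ?thesis
    using S(1) by (intro exI[of _ S]) (auto simp: V_def)
qed

section \<open>Asymptotics\<close>

text \<open>
  Here \<open>N\<close> is a lower bound for the average degree, namely \<open>n powr \<epsilon>\<close>. The constant \<open>\<theta>\<close> is chosen such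
  that \<open>(1 - 5 * \<theta>) ^ k \<ge> 49 / 50\<close>, so the losses in the \<open>k\<close> expansion steps stay below two percent.
  The density \<open>r\<close> uses the constant 14/5 in place of 3: this leaves room for Markov's inequality for the
  size of \<open>S\<close>, and for losses in the exponent, which must exceed 2 in the end.
\<close>

lemma exists_reconstructing_set_sparse_regime:
  fixes n j :: nat and p N :: real
  defines "k \<equiv> Suc j"
  defines "L \<equiv> ln (real n)" and "\<theta> \<equiv> 1 / (250 * real k)" and "\<Lambda> \<equiv> real n ^ k * p ^ Suc k"
  assumes p: "p \<le> 1" and N: "N < real n * p" and "0 < N"
    and sparse: "3 * exp \<Lambda> * L < (real n * p) ^ k"
    and L: "800 * (real k)\<^sup>2 \<le> L"
    and N1: "8 * real k * L \<le> \<theta> * N" and N2: "800 * (real k * L)\<^sup>2 \<le> N" and N3: "8 \<le> \<theta> * N"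
    and N4: "real n * exp (- (\<theta>\<^sup>2 * (N / 2))) \<le> 1"
  shows "\<exists>S\<subseteq>{1..n}. real (card S) \<le> 3 * exp \<Lambda> * L * real n / (real n * p) ^ k \<and>
    measure_pmf.prob (binomial_random_graph n p) {G. \<not> reconstructible n (pairs_meeting n S) G} \<le>
      16 * (real n * exp (- (N / L ^ 4)) + (real n)\<^sup>2 * (2 * real n * exp (- (\<theta>\<^sup>2 * (N / 2)))) +
        (real n)\<^sup>2 * exp (- (5 / 2 * L)))"
proof -
  define d where "d = real n * p"
  define q where "q = (1 + 2 / L\<^sup>2) ^ k"
  define \<Delta> where "\<Delta> = (1 + 2 * (1 / L\<^sup>2)) * (real n * p)"
  define \<mu> where "\<mu> = (1 - 2 * \<theta>) * d"
  define g where "g = (1 - 5 * \<theta>) * d"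
  define r where "r = 14 / 5 * exp \<Lambda> * L / d ^ k"
  have k1: "1 \<le> real k"
    by (simp add: k_def)
  have L1: "800 \<le> L"
    using L power_mono[OF k1, of 2] by simp
  then have n0: "0 < n"
    by (cases "n = 0") (auto simp: L_def)
  have \<theta>: "0 < \<theta>" "\<theta> \<le> 1 / 250" "5 * \<theta> * real k = 1 / 50"
    using k1 by (auto simp: \<theta>_def field_simps)
  have d0: "N < d" "0 < d"
    using N \<open>0 < N\<close> by (auto simp: d_def)
  have p0: "0 < p"
    using d0 n0 by (simp add: d_def zero_less_mult_iff)
  have "N * \<theta> \<le> N * (1 / 250)"
    using \<theta> \<open>0 < N\<close> by (intro mult_left_mono) auto
  then have N8: "2000 \<le> N"
    using N3 by (simp add: mult.commute)
  have d1: "2000 \<le> d"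
    using N8 d0 by simp
  have dn: "d \<le> real n"
    using p by (simp add: d_def mult_left_le)
  have \<Lambda>: "\<Lambda> = p * d ^ k"
    by (simp add: \<Lambda>_def d_def power_mult_distrib)
  have \<Lambda>0: "0 \<le> \<Lambda>"
    using p0 d0 by (simp add: \<Lambda>)
  have kL: "1 \<le> real k * L"
    using k1 L1 mult_mono[of 1 "real k" 1 L] by simp
  have \<Lambda>_le: "\<Lambda> \<le> real k * L"
  proof -
    have "exp \<Lambda> * 1 \<le> exp \<Lambda> * (3 * L)"
      using L1 by (intro mult_left_mono) auto
    also have "\<dots> = 3 * exp \<Lambda> * L"
      by simp
    also have "\<dots> < d ^ k"
      using sparse by (simp add: d_def)
    finally have "exp \<Lambda> < d ^ k"
      by simp
    then have "\<Lambda> \<le> ln (d ^ k)"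
      using d0 by (simp add: ln_ge_iff)
    also have "\<dots> = real k * ln d"
      using d0 by (simp add: ln_realpow)
    also have "\<dots> \<le> real k * L"
      unfolding L_def using dn d0 n0 by (intro mult_left_mono ln_mono) auto
    finally show ?thesis .
  qed
  \<comment> \<open>All smallness conditions follow from \<open>d * d ^ k = n * \<Lambda>\<close>, since \<open>\<Lambda> / d\<close> is tiny.\<close>
  have shrink: "8 * x \<le> \<theta> * y" if "d * x \<le> y * \<Lambda>" "0 \<le> x" "0 \<le> y" for x y
  proof -
    have "8 * (real k * L) * x \<le> \<theta> * N * x"
      using N1 that by (intro mult_right_mono) (auto simp: mult_ac)
    also have "\<dots> \<le> \<theta> * (d * x)"
      using d0 \<theta> that by (simp add: mult_right_mono)
    also have "\<dots> \<le> \<theta> * (y * \<Lambda>)"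
      using that \<theta> by simp
    also have "\<dots> \<le> \<theta> * (y * (real k * L))"
      using \<Lambda>_le that \<theta> by (intro mult_left_mono) auto
    finally have "(8 * x) * (real k * L) \<le> (\<theta> * y) * (real k * L)"
      by (simp add: mult_ac)
    then show ?thesis
      using kL by (simp add: mult_le_cancel_right)
  qed
  have dk: "8 * d ^ k \<le> \<theta> * real n"
    using d0 by (intro shrink) (simp_all add: \<Lambda> d_def mult_ac)
  have pdj: "8 * (p * d ^ j) \<le> \<theta> * 1"
    using p0 d0 by (intro shrink) (simp_all add: \<Lambda> k_def)
  have "d ^ 1 \<le> d ^ k"
    using d1 by (intro power_increasing) (auto simp: k_def)
  then have "N \<le> d ^ k"
    using d0 by simp
  then have "p * N \<le> p * d ^ k"
    using p0 by (intro mult_left_mono) auto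
  then have pN: "p * N \<le> real k * L"
    using \<Lambda>_le by (simp add: \<Lambda>)
  have pkL: "p * (real k * L) \<le> 1 / 800"
  proof -
    have "p * (800 * (real k * L)\<^sup>2) \<le> p * N"
      using N2 p0 by (intro mult_left_mono) auto
    then have "(800 * (p * (real k * L))) * (real k * L) \<le> 1 * (real k * L)"
      using pN by (simp add: power2_eq_square mult_ac)
    then have "800 * (p * (real k * L)) \<le> 1"
      by (rule mult_right_le_imp_le) (use kL in linarith)
    then show ?thesis
      by simp
  qed
  have p_small: "p \<le> 1 / 2"
    using pkL mult_left_mono[OF kL, of p] p0 by linarith
  \<comment> \<open>The relative error \<open>2 / L\<^sup>2\<close> of the degrees changes the exponent \<open>\<Lambda> \<le> k * L\<close> only by \<open>O(1 / L)\<close>.\<close>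
  have q: "1 \<le> q" "real k * L * (q - 1) \<le> 1 / 200"
  proof -
    have x: "0 \<le> real k * (2 / L\<^sup>2)" "real k * (2 / L\<^sup>2) \<le> 1"
    proof -
      have "real k \<le> (real k)\<^sup>2"
        using k1 by (simp add: power2_eq_square)
      then have "2 * real k \<le> L"
        using L k1 by linarith
      moreover have "L \<le> L\<^sup>2"
        using L1 by (simp add: power2_eq_square)
      ultimately show "real k * (2 / L\<^sup>2) \<le> 1"
        using L1 by (simp add: field_simps)
    qed simp
    have "q \<le> exp (2 / L\<^sup>2) ^ k"
      unfolding q_def by (intro power_mono) auto
    also have "\<dots> = exp (real k * (2 / L\<^sup>2))"
      by (simp flip: exp_of_nat_mult)
    also have "\<dots> \<le> 1 + real k * (2 / L\<^sup>2) + (real k * (2 / L\<^sup>2))\<^sup>2"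
      using x by (rule exp_bound)
    also have "(real k * (2 / L\<^sup>2))\<^sup>2 \<le> real k * (2 / L\<^sup>2)"
      using x mult_left_le[of "real k * (2 / L\<^sup>2)" "real k * (2 / L\<^sup>2)"] by (simp add: power2_eq_square)
    finally have "q - 1 \<le> 4 * real k / L\<^sup>2"
      by simp
    then have "real k * L * (q - 1) \<le> real k * L * (4 * real k / L\<^sup>2)"
      using kL by (intro mult_left_mono) auto
    also have "\<dots> = 4 * (real k)\<^sup>2 / L"
      using L1 by (simp add: power2_eq_square)
    also have "\<dots> \<le> 1 / 200"
      using L L1 by (simp add: field_simps)
    finally show "real k * L * (q - 1) \<le> 1 / 200" .
    show "1 \<le> q"
      unfolding q_def by (intro one_le_power) simp
  qed
  have "1 * (q - 1) \<le> real k * L * (q - 1)"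
    using kL q(1) by (intro mult_right_mono) auto
  then have "1 * (q - 1) \<le> 1 / 200"
    using q(2) by (rule order_trans)
  then have q2: "q \<le> 2"
    by simp
  have \<Delta>d: "\<Delta> = (1 + 2 / L\<^sup>2) * d"
    by (simp add: \<Delta>_def d_def)
  have \<Delta>k: "\<Delta> ^ k = q * d ^ k"
    by (simp add: \<Delta>d q_def power_mult_distrib)
  have "1 * d \<le> \<Delta>"
    unfolding \<Delta>d using d0 by (intro mult_right_mono) auto
  then have \<Delta>2: "2 \<le> \<Delta>"
    using d1 by simp
  have \<Delta>i: "\<Delta> ^ i \<le> 2 * d ^ i" if "i \<le> k" for i
  proof -
    have "(1 + 2 / L\<^sup>2) ^ i \<le> q"
      unfolding q_def using that by (intro power_increasing) auto
    then have "(1 + 2 / L\<^sup>2) ^ i \<le> 2"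
      using q2 by linarith
    then show ?thesis
      using d0 by (simp add: \<Delta>d power_mult_distrib mult_right_mono)
  qed
  have \<Delta>k_small: "4 * \<Delta> ^ Suc j \<le> \<theta> * real n"
    using \<Delta>i[of k] dk by (simp add: k_def)
  have g_power: "49 / 50 * d ^ i \<le> g ^ i" "g ^ i \<le> d ^ i" if "i \<le> k" for i
  proof -
    have "1 - real i * (5 * \<theta>) \<le> (1 - 5 * \<theta>) ^ i"
      using Bernoulli_inequality[of "- (5 * \<theta>)" i] \<theta> by simp
    moreover have "real i * (5 * \<theta>) \<le> real k * (5 * \<theta>)"
      using that \<theta> by (intro mult_right_mono) auto
    ultimately have "49 / 50 \<le> (1 - 5 * \<theta>) ^ i"
      using \<theta>(3) by (simp add: mult_ac)
    then show "49 / 50 * d ^ i \<le> g ^ i"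
      using d0 unfolding g_def power_mult_distrib by (intro mult_right_mono) auto
    have "(1 - 5 * \<theta>) ^ i \<le> 1"
      using \<theta> by (intro power_le_one) auto
    then show "g ^ i \<le> d ^ i"
      using d0 mult_right_mono[of "(1 - 5 * \<theta>) ^ i" 1 "d ^ i"] by (simp add: g_def power_mult_distrib)
  qed
  have \<mu>_ge: "N / 2 \<le> \<mu>"
  proof -
    have "N / 2 \<le> 1 / 2 * d"
      using d0 by simp
    also have "\<dots> \<le> (1 - 2 * \<theta>) * d"
      using \<theta> d0 by (intro mult_right_mono) auto
    finally show ?thesis
      by (simp only: \<mu>_def)
  qed
  have r0: "0 \<le> r"
    using L1 d0 by (simp add: r_def)
  define \<eta> where "\<eta> = real n * exp (- (N / L ^ 4)) + (real n)\<^sup>2 * (2 * real n * exp (- (\<theta>\<^sup>2 * (N / 2)))) +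
        (real n)\<^sup>2 * exp (- (5 / 2 * L))"
  define m where "m = 3 * exp \<Lambda> * L * real n / d ^ k"
  have "\<exists>S\<subseteq>{1..n}. real (card S) \<le> m \<and>
    measure_pmf.prob (binomial_random_graph n p) {G. \<not> reconstructible n (pairs_meeting n S) G} \<le> 16 * \<eta>"
  proof (rule exists_reconstructing_set[where j = j and \<tau> = "5 / 2 * L" and r = r and \<theta>' = "1 / L\<^sup>2" and \<theta> = \<theta>
        and \<Delta> = \<Delta> and \<mu> = \<mu> and g = g])
    show "0 \<le> p" "p \<le> 1" "0 \<le> r" "0 \<le> 1 / L\<^sup>2" "0 \<le> \<theta>" "\<theta> \<le> 1" "2 \<le> \<Delta>"
      using p0 p r0 \<theta> \<Delta>2 by auto
    show "1 / L\<^sup>2 \<le> 1"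
      using L1 by (simp add: power_le_one_iff one_le_power)
    show "r \<le> 1"
    proof -
      have "14 / 5 * exp \<Lambda> * L \<le> 3 * exp \<Lambda> * L"
        using L1 by (intro mult_right_mono) auto
      also have "\<dots> \<le> d ^ k"
        using sparse by (simp add: d_def)
      finally show ?thesis
        unfolding r_def using d0 by (intro divide_le_eq_1_pos[THEN iffD2]) auto
    qed
    show "\<Delta> = (1 + 2 * (1 / L\<^sup>2)) * (real n * p)"
      by (rule \<Delta>_def)
    show "real n * exp (- (\<theta>\<^sup>2 * \<mu>)) \<le> 1"
    proof -
      have "real n * exp (- (\<theta>\<^sup>2 * \<mu>)) \<le> real n * exp (- (\<theta>\<^sup>2 * (N / 2)))"
        using mult_left_mono[OF \<mu>_ge, of "\<theta>\<^sup>2"] by (intro mult_left_mono) auto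
      then show ?thesis
        using N4 by linarith
    qed
    show "0 < g"
      using \<theta> d0 by (simp add: g_def)
    show "0 \<le> (1 - 2 * \<theta>) * \<mu>"
      using \<theta> d0 by (simp add: \<mu>_def)
    show "0 < m"
      using L1 d0 n0 by (simp add: m_def)
    show "real n * r \<le> 14 / 15 * m"
      by (simp add: r_def m_def mult_ac)
    show "0 < \<eta>"
      using n0 unfolding \<eta>_def by (intro add_nonneg_pos) auto
    show "real n * exp (- ((1 / L\<^sup>2)\<^sup>2 * (real n * p))) + (real n)\<^sup>2 * (2 * real n * exp (- (\<theta>\<^sup>2 * \<mu>))) +
      (real n)\<^sup>2 * exp (- (5 / 2 * L)) \<le> \<eta>"
    proof -
      have "N / L ^ 4 \<le> (1 / L\<^sup>2)\<^sup>2 * (real n * p)"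
        using d0 by (simp add: d_def power_divide divide_right_mono flip: power_mult)
      moreover have "\<theta>\<^sup>2 * (N / 2) \<le> \<theta>\<^sup>2 * \<mu>"
        using \<mu>_ge by (intro mult_left_mono) auto
      ultimately show ?thesis
        unfolding \<eta>_def by (intro add_mono mult_left_mono) auto
    qed
  next
    fix a :: nat
    assume a: "1 \<le> a" "real a \<le> \<Delta> ^ j"
    have "real a \<le> 2 * d ^ j"
      using a(2) \<Delta>i[of j] by (simp add: k_def)
    then have "p * real a \<le> p * (2 * d ^ j)"
      using p0 by (intro mult_left_mono) auto
    then have pa: "p * real a \<le> \<theta>"
      using pdj \<theta>(1) by linarith
    have "(1 - p) ^ a \<le> exp (- (real a * p))"
      using p0 p by (intro one_minus_power_le_exp) auto
    then have "p * real a - (p * real a)\<^sup>2 \<le> 1 - (1 - p) ^ a"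
      using one_minus_exp_ge[of "p * real a"] p0 by (simp add: mult.commute)
    moreover have "(p * real a)\<^sup>2 \<le> \<theta> * (p * real a)"
      using pa p0 by (simp add: power2_eq_square mult_right_mono)
    ultimately have 1: "(1 - \<theta>) * (p * real a) \<le> 1 - (1 - p) ^ a"
      by (simp add: left_diff_distrib)
    have "1 \<le> \<Delta> ^ j" "\<Delta> ^ j \<le> \<Delta> ^ Suc j"
      using \<Delta>2 by (auto intro!: one_le_power power_increasing simp del: power_Suc)
    then have 2: "(1 - \<theta>) * real n \<le> real n - 2 * \<Delta> ^ Suc j - 1 - real a"
      using \<Delta>k_small a(2) unfolding left_diff_distrib by linarith
    have "\<mu> * real a = (1 - 2 * \<theta>) * (p * real a * real n)"
      by (simp add: \<mu>_def d_def)
    also have "\<dots> \<le> ((1 - \<theta>) * (1 - \<theta>)) * (p * real a * real n)"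
      using p0 by (intro mult_right_mono) (auto simp: algebra_simps)
    also have "\<dots> = ((1 - \<theta>) * (p * real a)) * ((1 - \<theta>) * real n)"
      by simp
    also have "\<dots> \<le> (1 - (1 - p) ^ a) * (real n - 2 * \<Delta> ^ Suc j - 1 - real a)"
      using 1 2 \<theta> p0 power_le_one[of "1 - p" a] p by (intro mult_mono) auto
    finally show "\<mu> * real a \<le> (1 - (1 - p) ^ a) * (real n - 2 * \<Delta> ^ Suc j - 1 - real a)" .
  next
    fix i assume i: "i < j"
    have "2 * \<Delta> ^ i \<le> 4 * d ^ i"
      using \<Delta>i[of i] i by (simp add: k_def)
    also have "\<dots> \<le> (\<theta> * d) * (49 / 50 * d ^ i)"
    proof -
      have "8 \<le> \<theta> * d"
        using N3 d0 \<theta> mult_left_mono[of N d \<theta>] by linarith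
      then have "8 * (49 / 50 * d ^ i) \<le> (\<theta> * d) * (49 / 50 * d ^ i)"
        using d0 by (intro mult_right_mono) auto
      moreover have "4 * d ^ i \<le> 8 * (49 / 50 * d ^ i)"
        using d0 by simp
      ultimately show ?thesis
        by linarith
    qed
    also have "\<dots> \<le> (\<theta> * d) * g ^ i"
      using g_power[of i] i \<theta> d0 by (intro mult_left_mono) (auto simp: k_def)
    also have "\<dots> \<le> ((1 - 2 * \<theta>) * \<mu> - g) * g ^ i"
    proof (rule mult_right_mono)
      have "(1 - 2 * \<theta>) * \<mu> - g = (\<theta> + 4 * \<theta>\<^sup>2) * d"
        by (simp add: \<mu>_def g_def algebra_simps power2_eq_square)
      then show "\<theta> * d \<le> (1 - 2 * \<theta>) * \<mu> - g"
        using d0 by (simp add: mult_right_mono)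
      show "0 \<le> g ^ i"
        using \<theta> d0 by (simp add: g_def)
    qed
    finally show "2 * \<Delta> ^ i \<le> ((1 - 2 * \<theta>) * \<mu> - g) * g ^ i" .
  next
    fix a b c :: nat
    assume a: "g ^ j \<le> real a" and b: "real b \<le> \<Delta> ^ Suc j" and c: "real n - 4 * \<Delta> ^ Suc j \<le> real c"
    define t where "t = p * g ^ j"
    have g0: "0 \<le> g ^ j"
      using \<theta> d0 by (simp add: g_def)
    have t: "0 \<le> t" "49 / 50 * (p * d ^ j) \<le> t" "t \<le> 1 / 2000"
    proof -
      show "0 \<le> t"
        using p0 g0 by (simp add: t_def)
      show "49 / 50 * (p * d ^ j) \<le> t"
        using mult_left_mono[OF g_power(1)[of j], of p] p0 by (simp add: t_def k_def)
      have "t \<le> p * d ^ j"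
        using mult_left_mono[OF g_power(2)[of j], of p] p0 by (simp add: t_def k_def)
      then show "t \<le> 1 / 2000"
        using pdj \<theta> by linarith
    qed
    have hit: "97 / 100 * (p * d ^ j) \<le> 1 - (1 - p) ^ a"
    proof -
      have "(1 - p) ^ a \<le> exp (- (real a * p))"
        using p0 p by (intro one_minus_power_le_exp) auto
      also have "\<dots> \<le> exp (- t)"
        using mult_left_mono[OF a, of p] p0 by (simp add: t_def mult.commute)
      finally have "t - t\<^sup>2 \<le> 1 - (1 - p) ^ a"
        using one_minus_exp_ge[OF t(1)] by linarith
      moreover have "t\<^sup>2 \<le> 1 / 2000 * t"
        unfolding power2_eq_square using t by (intro mult_right_mono) auto
      ultimately show ?thesis
        using t(1,2) by linarith
    qed
    have avoid: "99 / 100 * exp (- \<Lambda>) \<le> (1 - p) ^ b"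
    proof -
      have "real b \<le> q * d ^ k"
        using b \<Delta>k unfolding k_def by linarith
      then have "real b * (p + 2 * p\<^sup>2) \<le> (q * d ^ k) * (p + 2 * p\<^sup>2)"
        using p0 by (intro mult_right_mono) auto
      also have "\<dots> = \<Lambda> + \<Lambda> * (q - 1) + 2 * q * (p * \<Lambda>)"
        by (simp add: \<Lambda> algebra_simps power2_eq_square)
      also have "\<Lambda> * (q - 1) \<le> 1 / 200"
        using q \<Lambda>_le by (intro order_trans[OF mult_right_mono q(2)]) auto
      also have "2 * q * (p * \<Lambda>) \<le> 4 * (p * (real k * L))"
        using q q2 \<Lambda>_le \<Lambda>0 p0 by (intro mult_mono) auto
      also have "\<dots> \<le> 1 / 200"
        using pkL by simp
      finally have e: "real b * (p + 2 * p\<^sup>2) \<le> \<Lambda> + 1 / 100"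
        by simp
      have "99 / 100 * exp (- \<Lambda>) \<le> exp (- (1 / 100)) * exp (- \<Lambda>)"
        using exp_ge_add_one_self[of "- (1 / 100)"] by (intro mult_right_mono) auto
      also have "\<dots> = exp (- (\<Lambda> + 1 / 100))"
        by (simp add: mult_exp_exp)
      also have "\<dots> \<le> exp (real b * ln (1 - p))"
      proof -
        have "real b * (- p - 2 * p\<^sup>2) \<le> real b * ln (1 - p)"
          using ln_one_minus_pos_lower_bound[of p] p0 p_small by (intro mult_left_mono) auto
        then show ?thesis
          using e by (simp add: algebra_simps)
      qed
      also have "\<dots> = (1 - p) ^ b"
        using p_small by (simp add: exp_of_nat_mult)
      finally show ?thesis .
    qed
    have fresh: "99 / 100 * real n \<le> real c"
      using c \<Delta>k_small \<theta> mult_right_mono[of \<theta> "1 / 250" "real n"] by simp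
    \<comment> \<open>The product of the four constants is about 2.66.\<close>
    have "5 / 2 * L \<le> (99 / 100 * (97 / 100) * (99 / 100) * (14 / 5)) * L"
      using L1 by (intro mult_right_mono) auto
    also have "\<dots> = 99 / 100 * real n * (97 / 100 * (p * d ^ j) * (99 / 100 * exp (- \<Lambda>)) * r)"
    proof -
      have "real n * (p * d ^ j) = d ^ k"
        by (simp add: d_def k_def)
      moreover have "exp (- \<Lambda>) * exp \<Lambda> = 1"
        by (simp flip: exp_add)
      ultimately have "(real n * (p * d ^ j)) * (exp (- \<Lambda>) * exp \<Lambda>) / d ^ k = 1"
        using d0 by simp
      moreover have "99 / 100 * real n * (97 / 100 * x * (99 / 100 * e) * (14 / 5 * e' * L / D)) =
          (99 / 100 * (97 / 100) * (99 / 100) * (14 / 5)) * L * ((real n * x) * (e * e') / D)" for x e e' D :: real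
        by simp
      ultimately show ?thesis
        unfolding r_def by (simp only: mult_1_right)
    qed
    also have "\<dots> \<le> real c * ((1 - (1 - p) ^ a) * (1 - p) ^ b * r)"
      using hit avoid fresh r0 p0 d0 p power_le_one[of "1 - p" a]
      by (intro mult_mono) (auto intro!: mult_nonneg_nonneg)
    finally show "5 / 2 * L \<le> real c * ((1 - (1 - p) ^ a) * (1 - p) ^ b * r)" .
  qed
  then show ?thesis
    by (simp add: m_def \<eta>_def d_def)
qed

theorem theorem3:
  fixes k :: nat and \<epsilon> :: real and p :: "nat \<Rightarrow> real"
  assumes "k \<ge> 1" and "\<epsilon> > 0"
    and "\<And>n. 0 \<le> p n \<and> p n \<le> 1"
    and "eventually (\<lambda>n. p n > real n powr (- 1 + \<epsilon>)) sequentially"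
  shows "\<exists>Q :: nat \<Rightarrow> nat set set.
    (\<forall>n. Q n \<subseteq> nsets {1..n} 2 \<and>
         real (card (Q n)) \<le>
           3 / (real n powi (int k - 2) * p n ^ k) * exp (real n ^ k * p n ^ (k + 1)) * ln (real n)) \<and>
    (\<lambda>n. measure_pmf.prob (binomial_random_graph n (p n)) {G. reconstructible n (Q n) G})
      \<longlonglongrightarrow> 1"
proof -
  obtain j where k: "k = Suc j"
    using assms(1) by (cases k) auto
  define \<theta> where "\<theta> = 1 / (250 * real k)"
  define N where "N n = real n powr \<epsilon>" for n :: nat
  define \<eta> where "\<eta> n = real n * exp (- (N n / ln (real n) ^ 4)) +
      (real n)\<^sup>2 * (2 * real n * exp (- (\<theta>\<^sup>2 * (N n / 2)))) + (real n)\<^sup>2 * exp (- (5 / 2 * ln (real n)))" for n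
  define bound where "bound n = 3 / (real n powi (int k - 2) * p n ^ k) * exp (real n ^ k * p n ^ (k + 1)) * ln (real n)" for n
  define success where "success n Q = measure_pmf.prob (binomial_random_graph n (p n)) {G. reconstructible n Q G}" for n Q
  \<comment> \<open>The set \<open>{}\<close> is chosen for the finitely many \<open>n\<close> that are not large, where the bound is merely nonnegative.\<close>
  define large where "large n \<longleftrightarrow> 0 < n \<and> real n powr (- 1 + \<epsilon>) < p n \<and> 800 * (real k)\<^sup>2 \<le> ln (real n) \<and>
      8 * real k * ln (real n) \<le> \<theta> * N n \<and> 800 * (real k * ln (real n))\<^sup>2 \<le> N n \<and>
      8 \<le> \<theta> * N n \<and> real n * exp (- (\<theta>\<^sup>2 * (N n / 2))) \<le> 1" for n
  have pos: "0 < \<theta>" "0 < real k"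
    by (simp_all add: \<theta>_def k)
  have \<eta>0: "0 \<le> \<eta> n" for n
    by (simp add: \<eta>_def)
  have ex: "\<exists>Q \<subseteq> nsets {1..n} 2. real (card Q) \<le> bound n \<and> (large n \<longrightarrow> 1 - 16 * \<eta> n \<le> success n Q)" for n
  proof (cases "large n")
    case False
    have "0 \<le> bound n"
    proof (cases "n = 0")
      case False
      then have "0 \<le> ln (real n)"
        by simp
      then show ?thesis
        using assms(3)[of n] by (simp add: bound_def power_int_def)
    qed (simp add: bound_def)
    then show ?thesis
      using False by (intro exI[of _ "{}"]) simp
  next
    case True
    define d where "d = real n * p n"
    define \<Lambda> where "\<Lambda> = real n ^ k * p n ^ Suc k"
    have n0: "0 < n" and large: "real n powr (- 1 + \<epsilon>) < p n" "800 * (real k)\<^sup>2 \<le> ln (real n)"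
      using True by (auto simp: large_def)
    have N0: "0 < N n"
      using n0 by (simp add: N_def)
    have "real n * real n powr (- 1 + \<epsilon>) < real n * p n"
      using large n0 by simp
    moreover have "real n * real n powr (- 1 + \<epsilon>) = N n"
      using n0 powr_add[of "real n" 1 "- 1 + \<epsilon>"] by (simp add: N_def)
    ultimately have Nd: "N n < real n * p n"
      by simp
    have d0: "0 < d"
      using N0 Nd by (simp add: d_def)
    have bound: "bound n = 3 * exp \<Lambda> * ln (real n) * real n / d ^ k * real n"
    proof -
      have "real n powi (int k - 2) = real n ^ k / (real n)\<^sup>2"
        using n0 by (subst power_int_diff) auto
      then show ?thesis
        using n0 by (simp add: bound_def \<Lambda>_def d_def power_mult_distrib power2_eq_square)
    qed
    show ?thesis
    proof (cases "3 * exp \<Lambda> * ln (real n) < d ^ k")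
      case True
      then obtain S where S: "S \<subseteq> {1..n}" "real (card S) \<le> 3 * exp \<Lambda> * ln (real n) * real n / d ^ k"
          "measure_pmf.prob (binomial_random_graph n (p n)) {G. \<not> reconstructible n (pairs_meeting n S) G} \<le> 16 * \<eta> n"
        using exists_reconstructing_set_sparse_regime[of "p n" "N n" n j] assms(3)[of n] \<open>large n\<close> N0 Nd
        unfolding k[symmetric] large_def \<theta>_def[symmetric] \<eta>_def d_def \<Lambda>_def by blast
      have "real (card (pairs_meeting n S)) \<le> real (card S) * real n"
        using card_pairs_meeting[of S n] finite_subset[OF S(1)] by (simp flip: of_nat_mult)
      also have "\<dots> \<le> bound n"
        using S(2) unfolding bound by (intro mult_right_mono) auto
      finally have "real (card (pairs_meeting n S)) \<le> bound n" .
      moreover have "1 - 16 * \<eta> n \<le> success n (pairs_meeting n S)"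
      proof -
        have "{G. \<not> reconstructible n (pairs_meeting n S) G} = UNIV - {G. reconstructible n (pairs_meeting n S) G}"
          by auto
        then have "measure_pmf.prob (binomial_random_graph n (p n)) {G. \<not> reconstructible n (pairs_meeting n S) G} =
            1 - success n (pairs_meeting n S)"
          using measure_pmf.prob_compl[of "{G. reconstructible n (pairs_meeting n S) G}"]
          by (simp add: success_def)
        then show ?thesis
          using S(3) by simp
      qed
      moreover have "pairs_meeting n S \<subseteq> nsets {1..n} 2"
        by (auto simp: pairs_meeting_def)
      ultimately show ?thesis
        by blast
    next
      case False
      have all: "nsets {1..n} 2 = pairs_meeting n {1..n}"
        by (auto simp: pairs_meeting_def elim!: nsets2_E)
      have "real (card (nsets {1..n} 2)) \<le> real n * real n"
        using card_pairs_meeting[of "{1..n}" n] unfolding all by (simp flip: of_nat_mult)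
      also have "\<dots> \<le> bound n"
      proof -
        have "1 \<le> 3 * exp \<Lambda> * ln (real n) / d ^ k"
          using False d0 by (simp add: field_simps)
        then have "1 * (real n * real n) \<le> (3 * exp \<Lambda> * ln (real n) / d ^ k) * (real n * real n)"
          by (intro mult_right_mono) auto
        then show ?thesis
          by (simp add: bound)
      qed
      finally have "real (card (nsets {1..n} 2)) \<le> bound n" .
      moreover have "success n (nsets {1..n} 2) = 1"
      proof -
        have "reconstructible n (nsets {1..n} 2) G" if "G \<in> set_pmf (random_subset (nsets {1..n} 2) (p n))" for G
          using that set_random_subset[of "nsets {1..n} 2" "p n"] reconstructible_all_pairs by blast
        then show ?thesis
          unfolding success_def binomial_random_graph_eq
          by (subst measure_pmf.prob_eq_1) (simp_all add: AE_measure_pmf_iff)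
      qed
      ultimately show ?thesis
        using \<eta>0[of n] by (intro exI[of _ "nsets {1..n} 2"]) simp
    qed
  qed
  then obtain Q where Q: "\<And>n. Q n \<subseteq> nsets {1..n} 2" "\<And>n. real (card (Q n)) \<le> bound n"
      "\<And>n. large n \<Longrightarrow> 1 - 16 * \<eta> n \<le> success n (Q n)"
    by metis
  have "eventually (\<lambda>n. 0 < n) sequentially"
    by (rule eventually_gt_at_top)
  moreover have "eventually (\<lambda>n::nat. 800 * (real k)\<^sup>2 \<le> ln (real n)) sequentially"
    by real_asymp
  moreover have "eventually (\<lambda>n. 8 * real k * ln (real n) \<le> \<theta> * N n) sequentially"
    unfolding N_def using pos \<open>\<epsilon> > 0\<close> by real_asymp
  moreover have "eventually (\<lambda>n. 800 * (real k * ln (real n))\<^sup>2 \<le> N n) sequentially"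
    unfolding N_def using pos \<open>\<epsilon> > 0\<close> by real_asymp
  moreover have "eventually (\<lambda>n. 8 \<le> \<theta> * N n) sequentially"
    unfolding N_def using pos \<open>\<epsilon> > 0\<close> by real_asymp
  moreover have "eventually (\<lambda>n. real n * exp (- (\<theta>\<^sup>2 * (N n / 2))) \<le> 1) sequentially"
    unfolding N_def using pos \<open>\<epsilon> > 0\<close> by real_asymp
  ultimately have "eventually large sequentially"
    using assms(4) unfolding large_def by eventually_elim auto
  then have lower: "eventually (\<lambda>n. 1 - 16 * \<eta> n \<le> success n (Q n)) sequentially"
    by eventually_elim (rule Q(3))
  have "(\<lambda>n. 1 - 16 * \<eta> n) \<longlonglongrightarrow> 1"
    unfolding \<eta>_def N_def using pos \<open>\<epsilon> > 0\<close> by real_asymp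
  then have "(\<lambda>n. success n (Q n)) \<longlonglongrightarrow> 1"
    by (intro tendsto_sandwich[OF lower _ _ tendsto_const]) (simp_all add: success_def)
  then show ?thesis
    using Q unfolding bound_def success_def by blast
qed

end
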